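(* Let $M\in\mathrm{M}_n(\mathbb{K})$ and suppose $\mathbb{K}^n=V_1\oplus\cdots\oplus V_t$ where each $V_i$ is a $\mathbb{K}$-subspace with $V_iM^t\subseteq V_i$. Let $d_i=\dim_{\mathbb{K}}V_i$ and let $P_i\in\mathrm{M}_{d_i\times n}(\mathbb{K})$ be a matrix whose rows form a $\mathbb{K}$-basis of $V_i$. Let $\mathcal{C}\subseteq\mathbb{L}^n$ be an $M$-code with parameters $[n,k]$, $k\ge1$, such that $\mathcal{C}=(\mathcal{C}\cap(V_1)_{\mathbb{L}})\oplus\cdots\oplus(\mathcal{C}\cap(V_t)_{\mathbb{L}})$. For each $i$ set $k_i=\dim_{\mathbb{L}}(\mathcal{C}\cap(V_i)_{\mathbb{L}})$ and $\mathcal{C}_i=\{c\in\mathbb{L}^{d_i} : cP_i\in\mathcal{C}\cap(V_i)_{\mathbb{L}}\}$, and let $\Lambda=\{i : \mathcal{C}\cap(V_i)_{\mathbb{L}}\neq\{0\}\}$. Then: (1) the map $u:(c_1,\dots,c_t)\in\mathbb{L}^{d_1}\times\cdots\times\mathbb{L}^{d_t}\mapsto\sum_i c_iP_i\in\mathbb{L}^n$ restricts to an $\mathbb{L}$-isomorphism $\mathcal{C}_1\times\cdots\times\mathcal{C}_t\to\mathcal{C}$, and $M_r(\mathcal{C}_1\times\cdots\times\mathcal{C}_t)=M_r(\mathcal{C})$ for all $r\in\{1,\dots,k\}$ (the product viewed as a code in $\mathbb{L}^n$ by concatenation); (2) for all $r\in\{1,\dots,k\}$, $$M_r(\mathcal{C})=\min_{\substack{\sum_{i\in\Lambda}r_i=r\\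 r_i\in\{0,\dots,k_i\}}}\ \sum_{i\in\Lambda}M_{r_i}(\mathcal{C}_i)=\min_{\substack{\sum_{i\in\Lambda}r_i=r\\ r_i\in\{0,\dots,k_i\}}}\ \sum_{i\in\Lambda}M_{r_i}(\mathcal{C}\cap(V_i)_{\mathbb{L}});$$ (3) for all $i\in\Lambda$ and $r_i\in\{1,\dots,k_i\}$, $M_{r_i}(\mathcal{C}_i)\le d_i-k_i+r_i$; (4) for all $r\in\{1,\dots,k\}$, $$M_r(\mathcal{C})\le\min_{\substack{\sum_{i\in\Lambda}r_i=r\\ r_i\in\{0,\dots,k_i\}}}\Big(\sum_{i\in\Lambda,\ r_i\neq0}(d_i-k_i)\Big)+r.$$
   Context: Let $\mathbb{L}/\mathbb{K}$ be a field extension of finite degree $m$, and $n\ge 1$ an integer with $m\ge n$ (standing assumption). Vectors are row vectors. Fix a $\mathbb{K}$-basis $\mathcal{B}$ of $\mathbb{L}$; for $c=(c_1,\dots,c_n)\in\mathbb{L}^n$ let $M_{\mathcal{B}}(c)\in\mathrm{M}_{m\times n}(\mathbb{K})$ be the matrix whose $j$-th column is the coordinate vector of $c_j$ in $\mathcal{B}$. The rank support $\mathrm{Rsupp}(c)\subseteq\mathbb{K}^n$ is the $\mathbb{K}$-row space of $M_{\mathcal{B}}(c)$, and $\mathrm{wt}_R(c)=\dim_{\mathbb{K}}\mathrm{Rsupp}(c)$. For an $\mathbb{L}$-subspace $\mathcal{D}\subseteq\mathbb{L}^n$, $\mathrm{Rsupp}(\mathcal{D})$ is the $\mathbb{K}$-span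 of all $\mathrm{Rsupp}(d)$, $d\in\mathcal{D}$, and $\mathrm{wt}_R(\mathcal{D})=\dim_{\mathbb{K}}\mathrm{Rsupp}(\mathcal{D})$. A linear $[n,k]$ code is a $k$-dimensional $\mathbb{L}$-subspace $\mathcal{C}\subseteq\mathbb{L}^n$; for $1\le r\le k$, $M_r(\mathcal{C})=\min\{\mathrm{wt}_R(\mathcal{D}) : \mathcal{D}\subseteq\mathcal{C},\ \dim_{\mathbb{L}}\mathcal{D}=r\}$ (the $r$-th generalized rank weight), and $M_0(\mathcal{C})=0$ by convention. For $M\in\mathrm{M}_n(\mathbb{K})$, a linear code $\mathcal{C}\subseteq\mathbb{L}^n$ is an $M$-code if $cM^t\in\mathcal{C}$ for all $c\in\mathcal{C}$. For a $\mathbb{K}$-subspace $V\subseteq\mathbb{K}^n$, $V_{\mathbb{L}}$ denotes the $\mathbb{L}$-subspace of $\mathbb{L}^n$ spanned by $V$. *)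

theory Defs
  imports Main "HOL-Library.FuncSet"
begin

text \<open>Vectors of length n over a field 'a are lists of length n.  A subfield K of 'a
  is a set of elements of 'a; K-vectors are lists with entries in K.  Linear algebra over
  a subfield F (F = UNIV gives linear algebra over the big field L = 'a).\<close>

definition subfield :: "'a::field set \<Rightarrow> bool" where
  "subfield K \<longleftrightarrow> 0 \<in> K \<and> 1 \<in> K \<and> (\<forall>x\<in>K. \<forall>y\<in>K. x + y \<in> K \<and> x * y \<in> K)
     \<and> (\<forall>x\<in>K. - x \<in> K) \<and> (\<forall>x\<in>K. x \<noteq> 0 \<longrightarrow> inverse x \<in> K)"

definition vecs :: "'a set \<Rightarrow> nat \<Rightarrow> 'a list set" where
  "vecs F n = {v. length v = n \<and> set v \<subseteq> F}"

definition zvec :: "nat \<Rightarrow> 'a::field list" where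
  "zvec n = replicate n 0"

definition vadd :: "'a::field list \<Rightarrow> 'a list \<Rightarrow> 'a list" where
  "vadd v w = map2 (+) v w"

definition smult :: "'a::field \<Rightarrow> 'a list \<Rightarrow> 'a list" where
  "smult a v = map ((*) a) v"

definition vsum :: "nat \<Rightarrow> 'a::field list list \<Rightarrow> 'a list" where
  "vsum n vs = foldr vadd vs (zvec n)"

text \<open>Linear combination \<open>\<Sum>_j as_j vs_j\<close>; also the vector-matrix product \<open>c P\<close>
  where the rows of P are the list \<open>vs\<close>.\<close>
definition lincomb :: "nat \<Rightarrow> 'a::field list \<Rightarrow> 'a list list \<Rightarrow> 'a list" where
  "lincomb n as vs = vsum n (map2 smult as vs)"

definition fspan :: "'a::field set \<Rightarrow> nat \<Rightarrow> 'a list set \<Rightarrow> 'a list set" where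
  "fspan F n S = {lincomb n as vs | as vs. length as = length vs \<and> set as \<subseteq> F \<and> set vs \<subseteq> S}"

definition fsubspace :: "'a::field set \<Rightarrow> nat \<Rightarrow> 'a list set \<Rightarrow> bool" where
  "fsubspace F n W \<longleftrightarrow> W \<subseteq> vecs F n \<and> zvec n \<in> W \<and> (\<forall>v\<in>W. \<forall>w\<in>W. vadd v w \<in> W)
     \<and> (\<forall>a\<in>F. \<forall>v\<in>W. smult a v \<in> W)"

definition lin_indep :: "'a::field set \<Rightarrow> nat \<Rightarrow> 'a list list \<Rightarrow> bool" where
  "lin_indep F n vs \<longleftrightarrow> (\<forall>as. length as = length vs \<and> set as \<subseteq> F \<and> lincomb n as vs = zvec n
      \<longrightarrow> set as \<subseteq> {0})"

definition is_basis :: "'a::field set \<Rightarrow> nat \<Rightarrow> 'a list set \<Rightarrow> 'a list list \<Rightarrow> bool" where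
  "is_basis F n W bs \<longleftrightarrow> set bs \<subseteq> W \<and> lin_indep F n bs \<and> fspan F n (set bs) = W"

definition fdim :: "'a::field set \<Rightarrow> nat \<Rightarrow> 'a list set \<Rightarrow> nat" where
  "fdim F n W = (LEAST d. \<exists>bs. length bs = d \<and> set bs \<subseteq> W \<and> fspan F n (set bs) = W)"

definition field_basis :: "'a::field set \<Rightarrow> 'a list \<Rightarrow> bool" where
  "field_basis K B \<longleftrightarrow> (\<forall>x. \<exists>!ks. length ks = length B \<and> set ks \<subseteq> K \<and>
      x = (\<Sum>l<length B. ks ! l * B ! l))"

definition coords :: "'a::field set \<Rightarrow> 'a list \<Rightarrow> 'a \<Rightarrow> 'a list" where
  "coords K B x = (THE ks. length ks = length B \<and> set ks \<subseteq> K \<and> x = (\<Sum>l<length B. ks ! l * B ! l))"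

text \<open>Rank support of c: K-row space of \<open>M_B(c)\<close>; row l of \<open>M_B(c)\<close> is the list of
  l-th coordinates of the entries of c.\<close>
definition Rsupp :: "'a::field set \<Rightarrow> 'a list \<Rightarrow> nat \<Rightarrow> 'a list \<Rightarrow> 'a list set" where
  "Rsupp K B n c = fspan K n {map (\<lambda>x. coords K B x ! l) c | l. l < length B}"

definition RsuppD :: "'a::field set \<Rightarrow> 'a list \<Rightarrow> nat \<Rightarrow> 'a list set \<Rightarrow> 'a list set" where
  "RsuppD K B n D = fspan K n (\<Union>d\<in>D. Rsupp K B n d)"

definition wtR :: "'a::field set \<Rightarrow> 'a list \<Rightarrow> nat \<Rightarrow> 'a list set \<Rightarrow> nat" where
  "wtR K B n D = fdim K n (RsuppD K B n D)"

definition grw :: "'a::field set \<Rightarrow> 'a list \<Rightarrow> nat \<Rightarrow> 'a list set \<Rightarrow> nat \<Rightarrow> nat" where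
  "grw K B n C r = (if r = 0 then 0 else
     Min {wtR K B n D | D. fsubspace UNIV n D \<and> D \<subseteq> C \<and> fdim UNIV n D = r})"

text \<open>\<open>c M^t\<close> for an n\<times>n matrix M given as a function of (row, column).\<close>
definition mulMt :: "nat \<Rightarrow> 'a::field list \<Rightarrow> (nat \<Rightarrow> nat \<Rightarrow> 'a) \<Rightarrow> 'a list" where
  "mulMt n c M = map (\<lambda>i. \<Sum>j<n. c ! j * M i j) [0..<n]"

definition prodcode :: "nat \<Rightarrow> (nat \<Rightarrow> 'a list set) \<Rightarrow> 'a list set" where
  "prodcode t Cs = {concat cs | cs. length cs = t \<and> (\<forall>i<t. cs ! i \<in> Cs i)}"

end

theory Submission
  imports Defs
begin

text \<open>
  The dimension of a subspace of \<open>F\<^sup>n\<close> is the number of its pivots, i.e. of the positions at which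
  some vector of the subspace has its first nonzero entry. Cutting \<open>{..<n}\<close> into consecutive blocks
  therefore splits the dimension of a subspace \<open>D\<close> into the dimensions of the graded pieces of the
  filtration of \<open>D\<close> by leading zero blocks. Taking rank supports is compatible with this filtration,
  so the rank weight of a subcode \<open>D\<close> of a product is at least the sum of the weights of its graded
  pieces, while the product of subcodes of the factors attains such a sum. Together these give the
  formula for the generalized rank weights of a product code.

  Multiplication by a matrix over \<open>K\<close> with independent rows is injective over \<open>L\<close> as well and maps
  rank supports to rank supports, hence preserves generalized rank weights. This identifies \<open>C\<close> with
  the product of the \<open>C\<^sub>i\<close>, and each \<open>C\<^sub>i\<close> with the intersection of \<open>C\<close> and \<open>(V\<^sub>i)\<^sub>L\<close>.

  For the Singleton-type bound, consider the vectors of the code that vanish before its \<open>r\<close>-th pivot from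
  the right: they form an \<open>r\<close>-dimensional subcode, whose support avoids the \<open>k - r\<close> smaller pivots.
\<close>

section \<open>Linear algebra over a subfield\<close>

lemma subfieldD:
  assumes "subfield F"
  shows "0 \<in> F" "1 \<in> F" "\<And>x y. x \<in> F \<Longrightarrow> y \<in> F \<Longrightarrow> x + y \<in> F"
    "\<And>x y. x \<in> F \<Longrightarrow> y \<in> F \<Longrightarrow> x * y \<in> F" "\<And>x. x \<in> F \<Longrightarrow> - x \<in> F"
    "\<And>x. x \<in> F \<Longrightarrow> inverse x \<in> F"
  proof -
  show "0 \<in> F" "1 \<in> F" "\<And>x y. x \<in> F \<Longrightarrow> y \<in> F \<Longrightarrow> x + y \<in> F"
    "\<And>x y. x \<in> F \<Longrightarrow> y \<in> F \<Longrightarrow> x * y \<in> F" "\<And>x. x \<in> F \<Longrightarrow> - x \<in> F"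
    using assms unfolding subfield_def by blast+
  show "inverse x \<in> F" if "x \<in> F" for x
    using assms that unfolding subfield_def by (cases "x = 0") auto
qed

lemma subfield_UNIV: "subfield UNIV"
  by (simp add: subfield_def)

lemma subfield_sum:
  assumes "subfield F" "\<And>i. i \<in> I \<Longrightarrow> f i \<in> F"
  shows "sum f I \<in> F"
  using assms(2) by (induction I rule: infinite_finite_induct) (auto simp: subfieldD(1,3)[OF assms(1)])

section \<open>Vectors as lists, handled entry by entry\<close>

lemma vecs_iff_nth: "v \<in> vecs F n \<longleftrightarrow> length v = n \<and> (\<forall>j<n. v ! j \<in> F)"
  unfolding vecs_def by (auto simp: in_set_conv_nth subset_iff)

lemma vecs_length: "v \<in> vecs F n \<Longrightarrow> length v = n"
  by (simp add: vecs_def)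

lemma length_zvec [simp]: "length (zvec n) = n"
  by (simp add: zvec_def)

lemma nth_zvec [simp]: "j < n \<Longrightarrow> zvec n ! j = 0"
  by (simp add: zvec_def)

lemma length_smult [simp]: "length (smult a v) = length v"
  by (simp add: smult_def)

lemma nth_smult [simp]: "j < length v \<Longrightarrow> smult a v ! j = a * v ! j"
  by (simp add: smult_def)

lemma length_vadd [simp]: "length (vadd v w) = min (length v) (length w)"
  by (simp add: vadd_def)

lemma nth_vadd [simp]: "j < length v \<Longrightarrow> j < length w \<Longrightarrow> vadd v w ! j = v ! j + w ! j"
  by (simp add: vadd_def)

lemma vsum_Nil [simp]: "vsum n [] = zvec n"
  and vsum_Cons [simp]: "vsum n (v # vs) = vadd v (vsum n vs)"
  by (simp_all add: vsum_def)

lemma length_vsum: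
  assumes "\<And>v. v \<in> set vs \<Longrightarrow> length v = n"
  shows "length (vsum n vs) = n"
  using assms by (induction vs) auto

lemma nth_vsum:
  assumes "\<And>v. v \<in> set vs \<Longrightarrow> length v = n" "j < n"
  shows "vsum n vs ! j = (\<Sum>l<length vs. vs ! l ! j)"
  using assms(1)
proof (induction vs)
  case (Cons v vs)
  moreover have "length (vsum n vs) = n"
    by (rule length_vsum) (use Cons.prems in auto)
  ultimately show ?case
    using assms(2) by (simp add: sum.lessThan_Suc_shift del: sum.lessThan_Suc)
qed (use assms in simp)

lemma lincomb_Nil [simp]: "lincomb n [] [] = zvec n"
  and lincomb_Cons [simp]: "lincomb n (a # as) (v # vs) = vadd (smult a v) (lincomb n as vs)"
  by (simp_all add: lincomb_def)

lemma length_lincomb: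
  assumes "\<And>v. v \<in> set vs \<Longrightarrow> length v = n"
  shows "length (lincomb n as vs) = n"
  unfolding lincomb_def by (rule length_vsum) (auto dest!: set_zip_rightD simp: assms)

lemma nth_lincomb:
  assumes "length as = length vs" "\<And>v. v \<in> set vs \<Longrightarrow> length v = n" "j < n"
  shows "lincomb n as vs ! j = (\<Sum>l<length vs. as ! l * vs ! l ! j)"
proof -
  have "lincomb n as vs ! j = (\<Sum>l<length (map2 smult as vs). map2 smult as vs ! l ! j)"
    unfolding lincomb_def
    by (rule nth_vsum) (auto dest!: set_zip_rightD simp: assms)
  also have "\<dots> = (\<Sum>l<length vs. as ! l * vs ! l ! j)"
    by (rule sum.cong) (use assms in auto)
  finally show ?thesis .
qed

lemma lincomb_append:
  assumes "length as = length vs" "\<And>v. v \<in> set vs \<union> set ws \<Longrightarrow> length v = n"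
  shows "lincomb n (as @ bs) (vs @ ws) = vadd (lincomb n as vs) (lincomb n bs ws)"
  using assms
proof (induction as vs rule: list_induct2)
  case Nil
  then show ?case
    using length_lincomb[of ws n bs]
    by (auto intro!: nth_equalityI)
next
  case (Cons a as v vs)
  have len: "length (lincomb n as vs) = n" "length (lincomb n bs ws) = n" "length v = n"
    using Cons.prems by (auto intro: length_lincomb)
  have "lincomb n (as @ bs) (vs @ ws) = vadd (lincomb n as vs) (lincomb n bs ws)"
    by (rule Cons.IH) (use Cons.prems in auto)
  then show ?case
    using len by (auto intro!: nth_equalityI simp: add.assoc)
qed

section \<open>Subspaces and spans\<close>

lemma fsubspaceD:
  assumes "fsubspace F n W"
  shows "W \<subseteq> vecs F n" "zvec n \<in> W" "\<And>v w. v \<in> W \<Longrightarrow> w \<in> W \<Longrightarrow> vadd v w \<in> W"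
    "\<And>a v. a \<in> F \<Longrightarrow> v \<in> W \<Longrightarrow> smult a v \<in> W"
    "\<And>v. v \<in> W \<Longrightarrow> length v = n"
  using assms unfolding fsubspace_def vecs_def by auto

lemma vsum_in_fsubspace:
  assumes "fsubspace F n W" "set vs \<subseteq> W"
  shows "vsum n vs \<in> W"
  using assms(2) by (induction vs) (auto simp: fsubspaceD(2,3)[OF assms(1)])

lemma lincomb_in_fsubspace:
  assumes W: "fsubspace F n W" and "length as = length vs" "set as \<subseteq> F" "set vs \<subseteq> W"
  shows "lincomb n as vs \<in> W"
  using assms(2-) by (induction as vs rule: list_induct2) (auto intro: fsubspaceD(2-4)[OF W])

lemma fsubspace_vecs:
  assumes "subfield F"
  shows "fsubspace F n (vecs F n)"
  unfolding fsubspace_def by (auto simp: vecs_iff_nth subfieldD(1,3,4)[OF assms])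

lemma fspan_least:
  assumes "fsubspace F n W" "S \<subseteq> W"
  shows "fspan F n S \<subseteq> W"
  using lincomb_in_fsubspace[OF assms(1)] assms(2) unfolding fspan_def by blast

lemma fspan_fsubspace:
  assumes F: "subfield F" and S: "S \<subseteq> vecs F n"
  shows "fsubspace F n (fspan F n S)"
proof -
  have len: "length v = n" if "v \<in> S" for v
    using S that vecs_length by blast
  have "fspan F n S \<subseteq> vecs F n"
    by (rule fspan_least[OF fsubspace_vecs[OF F] S])
  moreover have "zvec n \<in> fspan F n S"
    unfolding fspan_def mem_Collect_eq
    by (rule exI[of _ "[]"], rule exI[of _ "[]"]) simp
  moreover have "vadd v w \<in> fspan F n S" if v: "v \<in> fspan F n S" and w: "w \<in> fspan F n S" for v w
  proof -
    obtain as vs where 1: "v = lincomb n as vs" "length as = length vs" "set as \<subseteq> F" "set vs \<subseteq> S"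
      using v unfolding fspan_def by blast
    obtain bs ws where 2: "w = lincomb n bs ws" "length bs = length ws" "set bs \<subseteq> F" "set ws \<subseteq> S"
      using w unfolding fspan_def by blast
    have "vadd v w = lincomb n (as @ bs) (vs @ ws)"
      using 1 2 len by (subst lincomb_append) auto
    then show ?thesis
      unfolding fspan_def mem_Collect_eq using 1 2
      by (intro exI[of _ "as @ bs"] exI[of _ "vs @ ws"]) auto
  qed
  moreover have "smult a v \<in> fspan F n S" if a: "a \<in> F" and v: "v \<in> fspan F n S" for a v
  proof -
    obtain as vs where 1: "v = lincomb n as vs" "length as = length vs" "set as \<subseteq> F" "set vs \<subseteq> S"
      using v unfolding fspan_def by blast
    have l: "\<And>v. v \<in> set vs \<Longrightarrow> length v = n"
      using 1 len by auto
    have "smult a v = lincomb n (map ((*) a) as) vs"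
      using 1 l by (auto intro!: nth_equalityI sum.cong
          simp: length_lincomb nth_lincomb sum_distrib_left mult.assoc)
    then show ?thesis
      unfolding fspan_def mem_Collect_eq using 1 a
      by (intro exI[of _ "map ((*) a) as"] exI[of _ "vs"]) (auto intro: subfieldD(4)[OF F])
  qed
  ultimately show ?thesis
    unfolding fsubspace_def by blast
qed

lemma fspan_superset:
  assumes F: "subfield F" and S: "S \<subseteq> vecs F n"
  shows "S \<subseteq> fspan F n S"
proof
  fix v assume v: "v \<in> S"
  then have "length v = n"
    using S vecs_length by blast
  then have "v = lincomb n [1] [v]"
    by (auto intro!: nth_equalityI)
  then show "v \<in> fspan F n S"
    unfolding fspan_def mem_Collect_eq using v subfieldD[OF F]
    by (intro exI[of _ "[1]"] exI[of _ "[v]"]) auto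
qed

lemma fspan_mono: "S \<subseteq> T \<Longrightarrow> fspan F n S \<subseteq> fspan F n T"
  unfolding fspan_def by blast

lemma fspan_mono_field: "F \<subseteq> G \<Longrightarrow> fspan F n S \<subseteq> fspan G n S"
  unfolding fspan_def by blast

text \<open>The right-hand side is a subspace containing \<open>b\<close> and \<open>S\<close>, so
  leastness of the span suffices. This avoids collecting repeated occurrences of \<open>b\<close> in
  a linear combination.\<close>

lemma fspan_insert_subset:
  assumes F: "subfield F" and b: "b \<in> vecs F n" and S: "S \<subseteq> vecs F n"
  shows "fspan F n (insert b S) \<subseteq> {vadd (smult a b) u | a u. a \<in> F \<and> u \<in> fspan F n S}" (is "_ \<subseteq> ?U")
proof (rule fspan_least)
  note FD = subfieldD[OF F]
  note SD = fsubspaceD[OF fspan_fsubspace[OF F S]]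
  have lb: "length b = n"
    using b vecs_length by blast
  show "fsubspace F n ?U"
    unfolding fsubspace_def
  proof (intro conjI ballI)
    show "?U \<subseteq> vecs F n"
      using SD(1) fsubspaceD[OF fsubspace_vecs[OF F, of n]] b by blast
    have "zvec n = vadd (smult 0 b) (zvec n)"
      using lb by (auto intro!: nth_equalityI)
    then show "zvec n \<in> ?U"
      using SD(2) FD(1) by blast
  next
    fix v w assume "v \<in> ?U" "w \<in> ?U"
    then obtain a u a' u' where *: "v = vadd (smult a b) u" "a \<in> F" "u \<in> fspan F n S"
       "w = vadd (smult a' b) u'" "a' \<in> F" "u' \<in> fspan F n S" by blast
    have "vadd v w = vadd (smult (a + a') b) (vadd u u')"
      using * lb SD(5) by (auto intro!: nth_equalityI simp: algebra_simps)
    then show "vadd v w \<in> ?U"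
      using * SD(3) FD(3) by blast
  next
    fix c v assume "c \<in> F" "v \<in> ?U"
    then obtain a u where *: "v = vadd (smult a b) u" "a \<in> F" "u \<in> fspan F n S" by blast
    have "smult c v = vadd (smult (c * a) b) (smult c u)"
      using * lb SD(5) by (auto intro!: nth_equalityI simp: algebra_simps)
    then show "smult c v \<in> ?U"
      using * SD(4) FD(4) \<open>c \<in> F\<close> by blast
  qed
  have "b = vadd (smult 1 b) (zvec n)"
    using lb by (auto intro!: nth_equalityI)
  then have "b \<in> ?U"
    using SD(2) FD(2) by blast
  moreover have "v \<in> ?U" if "v \<in> S" for v
  proof -
    have "v \<in> fspan F n S"
      using fspan_superset[OF F S] that by blast
    moreover from this have "v = vadd (smult 0 b) v"
      using lb SD(5) by (auto intro!: nth_equalityI)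
    ultimately show ?thesis
      using FD(1) by blast
  qed
  ultimately show "insert b S \<subseteq> ?U"
    by blast
qed

text \<open>\<open>fspan\<close> ranges over lists of any length, with repetitions. Splitting off
  one vector at a time leaves one coefficient per entry of \<open>bs\<close>, so the span becomes
  the set of products of row vectors with the matrix \<open>bs\<close>.\<close>

lemma fspan_set_eq_image:
  assumes F: "subfield F" and "set bs \<subseteq> vecs F n"
  shows "fspan F n (set bs) = (\<lambda>c. lincomb n c bs) ` vecs F (length bs)"
proof
  show "fspan F n (set bs) \<subseteq> (\<lambda>c. lincomb n c bs) ` vecs F (length bs)"
    using assms(2)
  proof (induction bs)
    case Nil
    then show ?case
      unfolding fspan_def vecs_def by auto
  next
    case (Cons b bs)
    show ?case
    proof
      fix v assume "v \<in> fspan F n (set (b # bs))"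
      then obtain a u where au: "v = vadd (smult a b) u" "a \<in> F" "u \<in> fspan F n (set bs)"
        using fspan_insert_subset[OF F, of b n "set bs"] Cons.prems by auto
      then obtain c where "u = lincomb n c bs" "c \<in> vecs F (length bs)"
        using Cons by auto
      then show "v \<in> (\<lambda>c. lincomb n c (b # bs)) ` vecs F (length (b # bs))"
        using au by (intro image_eqI[of _ _ "a # c"]) (auto simp: vecs_def)
    qed
  qed
  show "(\<lambda>c. lincomb n c bs) ` vecs F (length bs) \<subseteq> fspan F n (set bs)"
    unfolding fspan_def vecs_def by auto
qed

section \<open>Pivots and dimension\<close>

definition pivots :: "'a::field list set \<Rightarrow> nat set" where
  "pivots W = {j. \<exists>w\<in>W. j < length w \<and> w ! j \<noteq> 0 \<and> (\<forall>i<j. w ! i = 0)}"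

lemma pivots_mono: "U \<subseteq> W \<Longrightarrow> pivots U \<subseteq> pivots W"
  unfolding pivots_def by blast

lemma pivots_subset: "W \<subseteq> vecs F n \<Longrightarrow> pivots W \<subseteq> {..<n}"
  unfolding pivots_def vecs_def by auto

lemma finite_pivots: "W \<subseteq> vecs F n \<Longrightarrow> finite (pivots W)"
  by (rule finite_subset[OF pivots_subset]) auto

text \<open>Each further generator creates at most one new pivot: from the witnesses of two new
  pivots the generator can be eliminated, and what is left shows that the smaller pivot was there
  already.\<close>

lemma card_pivots_fspan_le:
  assumes F: "subfield F" and "set bs \<subseteq> vecs F n"
  shows "card (pivots (fspan F n (set bs))) \<le> length bs"
  using assms(2)
proof (induction bs)
  case Nil
  have "fspan F n (set []) \<subseteq> {zvec n}"
    by (auto simp: fspan_def)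
  then have "pivots (fspan F n (set [])) = {}"
    by (auto simp: pivots_def)
  then show ?case by simp
next
  case (Cons b bs)
  let ?U = "fspan F n (set bs)" and ?W = "fspan F n (set (b # bs))"
  have bs: "set bs \<subseteq> vecs F n" and b: "b \<in> vecs F n"
    using Cons.prems by auto
  note U = fsubspaceD[OF fspan_fsubspace[OF F bs]]
  note W = fsubspaceD[OF fspan_fsubspace[OF F Cons.prems]]
  have lb: "length b = n"
    using b vecs_length by blast
  have key: False
    if j: "j \<in> pivots ?W - pivots ?U" and j': "j' \<in> pivots ?W - pivots ?U" and "j < j'" for j j'
  proof -
    obtain w where w: "w \<in> ?W" "j < n" "w ! j \<noteq> 0" "\<forall>i<j. w ! i = 0"
      using j W(5) unfolding pivots_def by auto
    obtain w' where w': "w' \<in> ?W" "j' < n" "w' ! j' \<noteq> 0" "\<forall>i<j'. w' ! i = 0"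
      using j' W(5) unfolding pivots_def by auto
    obtain a u where au: "w = vadd (smult a b) u" "a \<in> F" "u \<in> ?U"
      using fspan_insert_subset[OF F b bs] w(1) by auto
    obtain a' u' where au': "w' = vadd (smult a' b) u'" "a' \<in> F" "u' \<in> ?U"
      using fspan_insert_subset[OF F b bs] w'(1) by auto
    have "a' \<noteq> 0"
    proof
      assume "a' = 0"
      then have "w' = u'"
        using au' U(5) lb by (auto intro!: nth_equalityI)
      then show False
        using w' au' j' U(5) unfolding pivots_def by auto
    qed
    \<comment> \<open>This is \<open>a' * w - a * w'\<close>, in which \<open>b\<close> cancels.
      Since \<open>w'\<close> vanishes up to and including position \<open>j < j'\<close>, the
      entries of \<open>x\<close> there are \<open>a'\<close> times those of
      \<open>w\<close>.\<close>
    define x where "x = vadd (smult a' u) (smult (- a) u')"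
    have x: "x \<in> ?U"
      unfolding x_def by (intro U(3,4) subfieldD(5)[OF F] au au')
    have x_eq: "x ! i = a' * w ! i - a * w' ! i" if "i < n" for i
      unfolding x_def au(1) au'(1) using that U(5)[OF au(3)] U(5)[OF au'(3)] lb
      by (simp add: algebra_simps)
    have "x ! j \<noteq> 0" "\<forall>i<j. x ! i = 0"
      using w w' \<open>j < j'\<close> \<open>a' \<noteq> 0\<close> by (auto simp: x_eq)
    then have "j \<in> pivots ?U"
      using x w(2) U(5) unfolding pivots_def by auto
    then show False
      using j by blast
  qed
  have fin: "finite (pivots ?U)"
    using finite_pivots U(1) by blast
  have "card (pivots ?W - pivots ?U) \<le> 1"
  proof -
    have "finite (pivots ?W - pivots ?U)"
      using finite_pivots[OF W(1)] by blast
    moreover have "j = j'" if "j \<in> pivots ?W - pivots ?U" "j' \<in> pivots ?W - pivots ?U" for j j'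
      using key[OF that] key[OF that(2,1)] by (meson nat_neq_iff)
    ultimately show ?thesis
      unfolding One_nat_def by (subst card_le_Suc0_iff_eq) blast+
  qed
  moreover have "card (pivots ?W) \<le> card (pivots ?U) + card (pivots ?W - pivots ?U)"
  proof -
    have "card (pivots ?W) \<le> card (pivots ?U \<union> (pivots ?W - pivots ?U))"
      using fin finite_pivots[OF W(1)] by (intro card_mono) auto
    then show ?thesis
      using card_Un_le order_trans by blast
  qed
  moreover have "card (pivots ?U) \<le> length bs"
    using Cons bs by blast
  ultimately show ?case by simp
qed

text \<open>Gaussian elimination: with one vector per pivot, the leading entry of any vector of
  \<open>W\<close> can be cleared, which moves its first nonzero position to the right.\<close>

lemma exists_pivot_basis:
  assumes F: "subfield F" and W: "fsubspace F n W"
  shows "\<exists>bs. length bs = card (pivots W) \<and> set bs \<subseteq> W \<and> fspan F n (set bs) = W"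
proof -
  note WD = fsubspaceD[OF W]
  have "\<forall>j\<in>pivots W. \<exists>w. w \<in> W \<and> j < n \<and> w ! j \<noteq> 0 \<and> (\<forall>i<j. w ! i = 0)"
    unfolding pivots_def using WD(5) by blast
  then obtain w where w: "\<And>j. j \<in> pivots W \<Longrightarrow> w j \<in> W \<and> j < n \<and> w j ! j \<noteq> 0 \<and> (\<forall>i<j. w j ! i = 0)"
    by metis
  have fin: "finite (pivots W)"
    using finite_pivots WD(1) by blast
  define bs where "bs = map w (sorted_list_of_set (pivots W))"
  have set_bs: "set bs = w ` pivots W"
    using fin by (simp add: bs_def)
  have bsW: "set bs \<subseteq> W"
    using w by (auto simp: set_bs)
  then have bsv: "set bs \<subseteq> vecs F n"
    using WD(1) by blast
  note SD = fsubspaceD[OF fspan_fsubspace[OF F bsv]]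
  \<comment> \<open>\<open>k\<close> counts the trailing positions that may still be nonzero. At
    \<open>k = n\<close> the condition is void, and this instance covers all of
    \<open>W\<close>.\<close>
  have span: "v \<in> fspan F n (set bs)" if "v \<in> W" "\<forall>i<n - k. v ! i = 0" for v k
    using that
  proof (induction k arbitrary: v)
    case 0
    then have "v = zvec n"
      using WD(5) by (auto intro!: nth_equalityI)
    then show ?case
      using SD(2) by simp
  next
    case (Suc k)
    show ?case
    proof (cases "Suc k \<le> n \<and> v ! (n - Suc k) \<noteq> 0")
      case False
      have "v ! i = 0" if "i < n - k" for i
      proof (cases "i < n - Suc k")
        case True
        then show ?thesis
          using Suc.prems(2) by blast
      next
        case i: False
        then have "Suc k \<le> n" "i = n - Suc k"
          using that by linarith+
        then show ?thesis
          using False by simp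
      qed
      then show ?thesis
        using Suc by blast
    next
      case True
      define j where "j = n - Suc k"
      have j: "j < n" "v ! j \<noteq> 0" "n - k = Suc j"
        using True by (auto simp: j_def)
      have lv: "length v = n"
        using WD(5) Suc.prems by blast
      have piv: "j \<in> pivots W"
        unfolding pivots_def mem_Collect_eq
        by (rule bexI[of _ v]) (use Suc.prems j lv in \<open>auto simp: j_def\<close>)
      define c where "c = v ! j * inverse (w j ! j)"
      have wj: "w j \<in> W" "length (w j) = n" "w j ! j \<noteq> 0" "\<forall>i<j. w j ! i = 0"
        using w[OF piv] WD(5) by auto
      have "v ! j \<in> F" "w j ! j \<in> F"
        using WD(1) Suc.prems(1) wj(1) j(1) vecs_iff_nth by blast+
      then have c: "c \<in> F" "- c \<in> F"
        unfolding c_def by (auto intro: subfieldD(4-6)[OF F])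
      have "vadd v (smult (- c) (w j)) \<in> fspan F n (set bs)"
      proof (rule Suc.IH)
        show "vadd v (smult (- c) (w j)) \<in> W"
          by (intro WD(3,4) Suc.prems(1) c wj)
        show "\<forall>i<n - k. vadd v (smult (- c) (w j)) ! i = 0"
          using Suc.prems(2) wj j lv by (auto simp: c_def less_Suc_eq j_def)
      qed
      moreover have "smult c (w j) \<in> fspan F n (set bs)"
        using SD(4) c(1) fspan_superset[OF F bsv] piv set_bs by blast
      ultimately have "vadd (vadd v (smult (- c) (w j))) (smult c (w j)) \<in> fspan F n (set bs)"
        using SD(3) by blast
      moreover have "vadd (vadd v (smult (- c) (w j))) (smult c (w j)) = v"
        using lv wj by (auto intro!: nth_equalityI)
      ultimately show ?thesis by simp
    qed
  qed
  have "W \<subseteq> fspan F n (set bs)"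
    using span[of _ n] by auto
  then have "fspan F n (set bs) = W"
    using fspan_least[OF W bsW] by blast
  moreover have "length bs = card (pivots W)"
    by (simp add: bs_def)
  ultimately show ?thesis
    using bsW by blast
qed

text \<open>The least length of a spanning list becomes a count of positions: a pivot basis attains
  it, and no spanning list has fewer entries than there are pivots.\<close>

lemma fdim_eq_card_pivots:
  assumes F: "subfield F" and W: "fsubspace F n W"
  shows "fdim F n W = card (pivots W)"
  unfolding fdim_def
proof (rule Least_equality)
  show "\<exists>bs. length bs = card (pivots W) \<and> set bs \<subseteq> W \<and> fspan F n (set bs) = W"
    by (rule exists_pivot_basis[OF assms])
  fix y assume "\<exists>bs. length bs = y \<and> set bs \<subseteq> W \<and> fspan F n (set bs) = W"
  then show "card (pivots W) \<le> y"
    using card_pivots_fspan_le[OF F] fsubspaceD(1)[OF W] by blast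
qed

lemma fdim_mono:
  assumes "subfield F" "fsubspace F n U" "fsubspace F n W" "U \<subseteq> W"
  shows "fdim F n U \<le> fdim F n W"
  unfolding fdim_eq_card_pivots[OF assms(1,2)] fdim_eq_card_pivots[OF assms(1,3)]
  by (rule card_mono[OF finite_pivots[OF fsubspaceD(1)[OF assms(3)]] pivots_mono[OF assms(4)]])

lemma fdim_le_of_vanishing:
  assumes F: "subfield F" and W: "fsubspace F n W" and "\<And>w i. w \<in> W \<Longrightarrow> i < j \<Longrightarrow> i < n \<Longrightarrow> w ! i = 0"
  shows "fdim F n W \<le> n - j"
proof -
  have "pivots W \<subseteq> {j..<n}"
  proof
    fix i assume "i \<in> pivots W"
    then obtain w where w: "w \<in> W" "i < length w" "w ! i \<noteq> 0"
      unfolding pivots_def by blast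
    then show "i \<in> {j..<n}"
      using assms(3)[of w i] fsubspaceD(5)[OF W w(1)] by (cases "i < j") auto
  qed
  then have "card (pivots W) \<le> card {j..<n}"
    by (intro card_mono) auto
  then show ?thesis
    by (simp add: fdim_eq_card_pivots[OF F W])
qed

lemma fdim_le: "subfield F \<Longrightarrow> fsubspace F n W \<Longrightarrow> fdim F n W \<le> n"
  using fdim_le_of_vanishing[of F n W 0] by simp

lemma fdim_vecs:
  assumes "subfield F"
  shows "fdim F n (vecs F n) = n"
proof -
  have "j \<in> pivots (vecs F n)" if "j < n" for j
    unfolding pivots_def mem_Collect_eq
    by (rule bexI[of _ "(replicate n 0)[j := 1]"])
      (use that subfieldD(1,2)[OF assms] in \<open>auto simp: vecs_iff_nth nth_list_update\<close>)
  then have "pivots (vecs F n) = {..<n}"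
    using pivots_subset[of "vecs F n" F n] by blast
  then show ?thesis
    by (simp add: fdim_eq_card_pivots fsubspace_vecs assms)
qed

lemma fsubspace_zero:
  assumes "subfield F"
  shows "fsubspace F n {zvec n}"
  unfolding fsubspace_def
  by (auto simp: vecs_iff_nth subfieldD(1)[OF assms] intro!: nth_equalityI)

lemma fdim_zero: "subfield F \<Longrightarrow> fdim F n {zvec n} = 0"
  using fdim_le_of_vanishing[of F n "{zvec n}" n] fsubspace_zero[of F n] fdim_le
  by (cases n) auto

section \<open>Multiplication by a matrix\<close>

text \<open>Associativity of the matrix product, by exchanging two finite sums. It says that
  multiplication by \<open>P\<close> commutes with linear combinations.\<close>

lemma lincomb_lincomb:
  assumes "length as = length vs" "\<And>v. v \<in> set vs \<Longrightarrow> length v = length P"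
    and P: "\<And>p. p \<in> set P \<Longrightarrow> length p = n"
  shows "lincomb n (lincomb (length P) as vs) P = lincomb n as (map (\<lambda>c. lincomb n c P) vs)"
proof (rule nth_equalityI)
  have len: "length (lincomb (length P) as vs) = length P"
    by (rule length_lincomb) (use assms in auto)
  have len': "\<And>c. length (lincomb n c P) = n"
    by (rule length_lincomb) (use P in auto)
  have len2: "length (lincomb n as (map (\<lambda>c. lincomb n c P) vs)) = n"
    by (rule length_lincomb) (auto simp: len')
  show "length (lincomb n (lincomb (length P) as vs) P)
      = length (lincomb n as (map (\<lambda>c. lincomb n c P) vs))"
    by (simp add: len' len2)
  fix j assume "j < length (lincomb n (lincomb (length P) as vs) P)"
  then have j: "j < n"
    by (simp add: len')
  have "lincomb n (lincomb (length P) as vs) P ! j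
      = (\<Sum>x<length P. (\<Sum>l<length vs. as ! l * vs ! l ! x) * P ! x ! j)"
    using assms len j by (simp add: nth_lincomb)
  also have "\<dots> = (\<Sum>l<length vs. as ! l * (\<Sum>x<length P. vs ! l ! x * P ! x ! j))"
    by (simp add: sum_distrib_right sum_distrib_left mult.assoc) (rule sum.swap)
  also have "\<dots> = (\<Sum>l<length vs. as ! l * lincomb n (vs ! l) P ! j)"
    by (rule sum.cong[OF refl]) (use assms j in \<open>simp add: nth_lincomb\<close>)
  also have "\<dots> = lincomb n as (map (\<lambda>c. lincomb n c P) vs) ! j"
    using assms(1) j len' by (subst nth_lincomb) auto
  finally show "lincomb n (lincomb (length P) as vs) P ! j
      = lincomb n as (map (\<lambda>c. lincomb n c P) vs) ! j" .
qed

lemma lincomb_vadd_left: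
  assumes "length c = length P" "length c' = length P" "\<And>p. p \<in> set P \<Longrightarrow> length p = n"
  shows "lincomb n (vadd c c') P = vadd (lincomb n c P) (lincomb n c' P)"
  using assms by (auto intro!: nth_equalityI
      simp: length_lincomb nth_lincomb sum.distrib algebra_simps)

lemma lincomb_smult_left:
  assumes "length c = length P" "\<And>p. p \<in> set P \<Longrightarrow> length p = n"
  shows "lincomb n (smult a c) P = smult a (lincomb n c P)"
  using assms by (auto intro!: nth_equalityI
      simp: length_lincomb nth_lincomb sum_distrib_left algebra_simps)

lemma lincomb_zvec_left:
  assumes "\<And>p. p \<in> set P \<Longrightarrow> length p = n"
  shows "lincomb n (zvec (length P)) P = zvec n"
  using assms by (auto intro!: nth_equalityI simp: length_lincomb nth_lincomb)

lemma fsubspace_lincomb_image: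
  assumes P: "set P \<subseteq> vecs F n" and F: "subfield F" and W: "fsubspace F (length P) W"
  shows "fsubspace F n ((\<lambda>c. lincomb n c P) ` W)"
proof -
  note WD = fsubspaceD[OF W]
  have len: "\<And>p. p \<in> set P \<Longrightarrow> length p = n"
    using P vecs_length by blast
  have "(\<lambda>c. lincomb n c P) ` W \<subseteq> vecs F n"
    using fspan_set_eq_image[OF F P] fsubspaceD(1)[OF fspan_fsubspace[OF F P]] WD(1) by blast
  moreover have "zvec n = lincomb n (zvec (length P)) P"
    using lincomb_zvec_left[OF len] by simp
  moreover have "vadd (lincomb n c P) (lincomb n c' P) \<in> (\<lambda>c. lincomb n c P) ` W"
    if "c \<in> W" "c' \<in> W" for c c'
    using lincomb_vadd_left[OF WD(5)[OF that(1)] WD(5)[OF that(2)] len] WD(3)[OF that]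
    by (metis imageI)
  moreover have "smult a (lincomb n c P) \<in> (\<lambda>c. lincomb n c P) ` W"
    if "a \<in> F" "c \<in> W" for a c
    using lincomb_smult_left[OF WD(5)[OF that(2)] len] WD(4)[OF that]
    by (metis imageI)
  ultimately show ?thesis
    using WD(2) unfolding fsubspace_def by blast
qed

lemma ex_map_of_subset_image:
  assumes "set ys \<subseteq> f ` S"
  shows "\<exists>xs. set xs \<subseteq> S \<and> map f xs = ys"
  using assms by (metis in_lists_conv_set lists_image imageE subset_code(1))

lemma fspan_lincomb_image:
  assumes P: "\<And>p. p \<in> set P \<Longrightarrow> length p = n" and S: "\<And>v. v \<in> S \<Longrightarrow> length v = length P"
  shows "(\<lambda>c. lincomb n c P) ` fspan F (length P) S = fspan F n ((\<lambda>c. lincomb n c P) ` S)"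
    (is "?f ` _ = _")
proof
  show "?f ` fspan F (length P) S \<subseteq> fspan F n (?f ` S)"
  proof
    fix x assume "x \<in> ?f ` fspan F (length P) S"
    then obtain as vs where *: "x = ?f (lincomb (length P) as vs)" "length as = length vs"
        "set as \<subseteq> F" "set vs \<subseteq> S"
      unfolding fspan_def by blast
    then have "x = lincomb n as (map ?f vs)"
      using lincomb_lincomb[OF *(2) _ P] S by blast
    then show "x \<in> fspan F n (?f ` S)"
      unfolding fspan_def mem_Collect_eq using *
      by (intro exI[of _ as] exI[of _ "map ?f vs"]) auto
  qed
  show "fspan F n (?f ` S) \<subseteq> ?f ` fspan F (length P) S"
  proof
    fix x assume "x \<in> fspan F n (?f ` S)"
    then obtain as vs where *: "x = lincomb n as vs" "length as = length vs"
        "set as \<subseteq> F" "set vs \<subseteq> ?f ` S"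
      unfolding fspan_def by blast
    obtain ws where ws: "set ws \<subseteq> S" "map ?f ws = vs"
      using ex_map_of_subset_image[OF *(4)] by blast
    then have lw: "length as = length ws"
      using * by auto
    then have "x = ?f (lincomb (length P) as ws)"
      using lincomb_lincomb[OF lw _ P] S ws * by (metis subsetD)
    moreover have "lincomb (length P) as ws \<in> fspan F (length P) S"
      unfolding fspan_def using ws lw * by blast
    ultimately show "x \<in> ?f ` fspan F (length P) S"
      by blast
  qed
qed

text \<open>The map moves pivots in no controlled way, so the argument uses spanning lists. They are
  pushed forward by linearity and pulled back entry by entry, where injectivity turns equality of
  images into equality of subspaces. Applied over \<open>K\<close> to rank supports and over
  \<open>UNIV\<close> to codes.\<close>

lemma fdim_lincomb_image:
  assumes P: "\<And>p. p \<in> set P \<Longrightarrow> length p = n" and W: "fsubspace F (length P) W"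
    and inj: "inj_on (\<lambda>c. lincomb n c P) W"
  shows "fdim F n ((\<lambda>c. lincomb n c P) ` W) = fdim F (length P) W"
proof -
  let ?f = "\<lambda>c. lincomb n c P"
  have img: "?f ` fspan F (length P) S = fspan F n (?f ` S)" if "S \<subseteq> W" for S
    by (rule fspan_lincomb_image) (use that P fsubspaceD(5)[OF W] in auto)
  have "(\<exists>bs. length bs = x \<and> set bs \<subseteq> ?f ` W \<and> fspan F n (set bs) = ?f ` W)
      \<longleftrightarrow> (\<exists>bs. length bs = x \<and> set bs \<subseteq> W \<and> fspan F (length P) (set bs) = W)" for x
  proof
    assume "\<exists>bs. length bs = x \<and> set bs \<subseteq> ?f ` W \<and> fspan F n (set bs) = ?f ` W"
    then obtain bs where bs: "length bs = x" "set bs \<subseteq> ?f ` W" "fspan F n (set bs) = ?f ` W"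
      by blast
    obtain cs where cs: "set cs \<subseteq> W" "map ?f cs = bs"
      using ex_map_of_subset_image[OF bs(2)] by blast
    then have "?f ` set cs = set bs"
      by (metis set_map)
    then have "?f ` fspan F (length P) (set cs) = ?f ` W"
      using img[OF cs(1)] bs by simp
    moreover have "fspan F (length P) (set cs) \<subseteq> W"
      by (rule fspan_least[OF W cs(1)])
    ultimately have "fspan F (length P) (set cs) = W"
      using inj by (metis inj_on_image_eq_iff order_refl)
    then show "\<exists>bs. length bs = x \<and> set bs \<subseteq> W \<and> fspan F (length P) (set bs) = W"
      using cs bs by (intro exI[of _ cs]) auto
  next
    assume "\<exists>bs. length bs = x \<and> set bs \<subseteq> W \<and> fspan F (length P) (set bs) = W"
    then obtain bs where bs: "length bs = x" "set bs \<subseteq> W" "fspan F (length P) (set bs) = W"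
      by blast
    then show "\<exists>bs. length bs = x \<and> set bs \<subseteq> ?f ` W \<and> fspan F n (set bs) = ?f ` W"
      using img[OF bs(2)] by (intro exI[of _ "map ?f bs"]) auto
  qed
  then show ?thesis
    unfolding fdim_def by simp
qed

lemma lin_indep_inj_on:
  assumes F: "subfield F" and P: "\<And>p. p \<in> set P \<Longrightarrow> length p = n" and ind: "lin_indep F n P"
  shows "inj_on (\<lambda>c. lincomb n c P) (vecs F (length P))"
proof (rule inj_onI)
  fix c c' assume c: "c \<in> vecs F (length P)" "c' \<in> vecs F (length P)"
    and eq: "lincomb n c P = lincomb n c' P"
  note VD = fsubspaceD[OF fsubspace_vecs[OF F, of "length P"]]
  define x where "x = vadd c (smult (- 1) c')"
  have len: "length c = length P" "length c' = length P"
    using c vecs_length by blast+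
  have "lincomb n x P = vadd (lincomb n c P) (smult (- 1) (lincomb n c' P))"
    unfolding x_def using len P by (simp add: lincomb_vadd_left lincomb_smult_left)
  also have "\<dots> = zvec n"
    unfolding eq using P by (auto intro!: nth_equalityI simp: length_lincomb)
  finally have 0: "lincomb n x P = zvec n" .
  have "x \<in> vecs F (length P)"
    unfolding x_def by (intro VD(3,4) c subfieldD(2,5)[OF F])
  then have x: "length x = length P" "set x \<subseteq> F"
    by (auto simp: vecs_def)
  then have "set x \<subseteq> {0}"
    using ind 0 unfolding lin_indep_def by blast
  then have "x ! j = 0" if "j < length P" for j
    using that x by (metis nth_mem singletonD subsetD)
  then show "c = c'"
    using len by (auto intro!: nth_equalityI simp: x_def)
qed

text \<open>Block multiplication: a concatenated row vector times the stacked matrices is the sum of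
  the blockwise products. This makes the map \<open>u\<close> of the theorem a product with a single
  matrix.\<close>

lemma lincomb_concat:
  assumes "length cs = length Ps" "\<And>i. i < length cs \<Longrightarrow> length (cs ! i) = length (Ps ! i)"
    and "\<And>p. p \<in> set (concat Ps) \<Longrightarrow> length p = n"
  shows "lincomb n (concat cs) (concat Ps) = vsum n (map2 (lincomb n) cs Ps)"
  using assms
proof (induction cs Ps rule: list_induct2)
  case (Cons c cs P Ps)
  have "lincomb n (concat cs) (concat Ps) = vsum n (map2 (lincomb n) cs Ps)"
    by (rule Cons.IH) (use Cons.prems(1)[of "Suc _"] Cons.prems(2) in auto)
  moreover have "lincomb n (c @ concat cs) (P @ concat Ps)
      = vadd (lincomb n c P) (lincomb n (concat cs) (concat Ps))"
    by (rule lincomb_append) (use Cons.prems(1)[of 0] Cons.prems(2) in auto)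
  ultimately show ?case by simp
qed simp

lemma fsubspace_Int:
  assumes "fsubspace F n U" "fsubspace F n W"
  shows "fsubspace F n (U \<inter> W)"
  using assms unfolding fsubspace_def by blast

lemma fsubspace_lincomb_vimage:
  assumes F: "subfield F" and P: "set P \<subseteq> vecs F n" and W: "fsubspace F n W"
  shows "fsubspace F (length P) {c \<in> vecs F (length P). lincomb n c P \<in> W}"
proof -
  have len: "\<And>p. p \<in> set P \<Longrightarrow> length p = n"
    using P vecs_length by blast
  note VD = fsubspaceD[OF fsubspace_vecs[OF F, of "length P"]] and WD = fsubspaceD[OF W]
  show ?thesis
    unfolding fsubspace_def
  proof (intro conjI ballI)
    show "zvec (length P) \<in> {c \<in> vecs F (length P). lincomb n c P \<in> W}"
      using VD(2) WD(2) lincomb_zvec_left[of P n] len by simp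
    show "vadd v w \<in> {c \<in> vecs F (length P). lincomb n c P \<in> W}"
      if "v \<in> {c \<in> vecs F (length P). lincomb n c P \<in> W}"
        "w \<in> {c \<in> vecs F (length P). lincomb n c P \<in> W}" for v w
      using that VD(3)[of v w] VD(5)[of v] VD(5)[of w] WD(3) lincomb_vadd_left[of v P w n] len
      by simp
    show "smult a v \<in> {c \<in> vecs F (length P). lincomb n c P \<in> W}"
      if "a \<in> F" "v \<in> {c \<in> vecs F (length P). lincomb n c P \<in> W}" for a v
      using that VD(4)[of a v] VD(5)[of v] WD(4) lincomb_smult_left[of v P n a] len
      by simp
  qed auto
qed

text \<open>Supplies subcodes of every dimension \<open>r\<close> as well as the vanishing behind
  the Singleton-type bound. At most \<open>j\<close> pivots lie before position \<open>j\<close>,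
  whence the inequality. The guard \<open>i < n\<close> keeps indices in range, since the conclusion
  does not record \<open>j \<le> n\<close>.\<close>

lemma exists_subspace_fdim_vanishing:
  assumes F: "subfield F" and C: "fsubspace F n C" and r: "r \<le> fdim F n C"
  shows "\<exists>D j. fsubspace F n D \<and> D \<subseteq> C \<and> fdim F n D = r \<and> fdim F n C \<le> j + r
    \<and> (\<forall>c\<in>D. \<forall>i<j. i < n \<longrightarrow> c ! i = 0)"
proof -
  note CD = fsubspaceD[OF C]
  let ?Q = "pivots C"
  define f where "f j = card {p \<in> ?Q. p \<ge> j}" for j
  have fin: "finite ?Q"
    using finite_pivots[OF CD(1)] .
  have f0: "f 0 = fdim F n C"
    by (simp add: f_def fdim_eq_card_pivots[OF F C])
  have fn: "f n = 0"
  proof -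
    have "{p \<in> ?Q. p \<ge> n} = {}"
      using pivots_subset[OF CD(1)] by auto
    then show ?thesis
      by (simp only: f_def card.empty)
  qed
  have step: "f j \<le> Suc (f (Suc j))" for j
  proof -
    have "{p \<in> ?Q. p \<ge> j} \<subseteq> insert j {p \<in> ?Q. p \<ge> Suc j}"
      by auto
    then have "f j \<le> card (insert j {p \<in> ?Q. p \<ge> Suc j})"
      unfolding f_def using fin by (intro card_mono) auto
    also have "\<dots> \<le> Suc (f (Suc j))"
      unfolding f_def by (rule card_insert_le_m1) auto
    finally show ?thesis .
  qed
  \<comment> \<open>\<open>f\<close> falls from the dimension of \<open>C\<close> to
    \<open>0\<close> by at most one per step, so at the first index where it is at most
    \<open>r\<close> it equals \<open>r\<close>.\<close>
  define j where "j = (LEAST j. f j \<le> r)"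
  have fj: "f j \<le> r"
    unfolding j_def by (rule LeastI[of _ n]) (simp add: fn)
  have "f j = r"
  proof (cases j)
    case 0
    then show ?thesis
      using fj f0 r by simp
  next
    case (Suc i)
    then have "\<not> f i \<le> r"
      unfolding j_def using not_less_Least[of i "\<lambda>j. f j \<le> r"] by simp
    then show ?thesis
      using step[of i] fj Suc by simp
  qed
  define D where "D = {c \<in> C. \<forall>i<j. i < n \<longrightarrow> c ! i = 0}"
  have D: "fsubspace F n D"
    unfolding fsubspace_def
  proof (intro conjI ballI)
    show "D \<subseteq> vecs F n"
      using CD(1) by (auto simp: D_def)
    show "zvec n \<in> D"
      using CD(2) by (auto simp: D_def)
    show "vadd v w \<in> D" if "v \<in> D" "w \<in> D" for v w
      using that CD(3)[of v w] CD(5)[of v] CD(5)[of w] by (auto simp: D_def)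
    show "smult a v \<in> D" if "a \<in> F" "v \<in> D" for a v
      using that CD(4)[of a v] CD(5)[of v] by (auto simp: D_def)
  qed
  \<comment> \<open>A vector of \<open>C\<close> witnessing a pivot \<open>p \<ge> j\<close>
    vanishes before \<open>p\<close>, hence before \<open>j\<close>, and so lies in
    \<open>D\<close>.\<close>
  have "pivots D = {p \<in> ?Q. p \<ge> j}"
  proof
    show "pivots D \<subseteq> {p \<in> ?Q. p \<ge> j}"
    proof
      fix p assume "p \<in> pivots D"
      then obtain w where w: "w \<in> D" "p < length w" "w ! p \<noteq> 0" "\<forall>i<p. w ! i = 0"
        unfolding pivots_def by blast
      moreover have "w \<in> C" "p < n"
        using w CD(5) unfolding D_def by auto
      ultimately show "p \<in> {p \<in> ?Q. p \<ge> j}"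
        unfolding D_def pivots_def using not_less by blast
    qed
    show "{p \<in> ?Q. p \<ge> j} \<subseteq> pivots D"
      unfolding D_def pivots_def by auto
  qed
  then have "fdim F n D = r"
    using \<open>f j = r\<close> by (simp add: fdim_eq_card_pivots[OF F D] f_def)
  moreover have "fdim F n C \<le> j + r"
  proof -
    have "?Q = {p \<in> ?Q. p \<ge> j} \<union> {p \<in> ?Q. p < j}"
      by auto
    then have "card ?Q \<le> card {p \<in> ?Q. p \<ge> j} + card {p \<in> ?Q. p < j}"
      by (metis card_Un_le)
    moreover have "card {p \<in> ?Q. p < j} \<le> card {..<j}"
      by (rule card_mono) auto
    ultimately show ?thesis
      using \<open>f j = r\<close> by (simp add: fdim_eq_card_pivots[OF F C] f_def)
  qed
  ultimately show ?thesis
    using D by (intro exI[of _ D] exI[of _ j]) (auto simp: D_def)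
qed

section \<open>Block decompositions\<close>

text \<open>\<open>d\<close> gives the block lengths; block \<open>i\<close> occupies the positions
  from \<open>offs d i\<close> up to, but excluding, \<open>offs d (Suc i)\<close>.\<close>

definition offs :: "(nat \<Rightarrow> nat) \<Rightarrow> nat \<Rightarrow> nat" where
  "offs d i = (\<Sum>l<i. d l)"

definition slice :: "(nat \<Rightarrow> nat) \<Rightarrow> nat \<Rightarrow> 'a list \<Rightarrow> 'a list" where
  "slice d i c = take (d i) (drop (offs d i) c)"

lemma offs_Suc [simp]: "offs d (Suc i) = offs d i + d i"
  by (simp add: offs_def)

lemma offs_mono: "i \<le> j \<Longrightarrow> offs d i \<le> offs d j"
  unfolding offs_def by (rule sum_mono2) auto

lemma offs_add_le: "i < t \<Longrightarrow> offs d i + d i \<le> offs d t"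
  using offs_mono[of "Suc i" t d] by simp

lemma length_slice: "i < t \<Longrightarrow> length c = offs d t \<Longrightarrow> length (slice d i c) = d i"
  using offs_add_le[of i t d] by (simp add: slice_def)

lemma nth_slice: "i < t \<Longrightarrow> length c = offs d t \<Longrightarrow> j < d i \<Longrightarrow> slice d i c ! j = c ! (offs d i + j)"
  using offs_add_le[of i t d] by (simp add: slice_def)

lemma concat_slices:
  assumes "length c = offs d t"
  shows "concat (map (\<lambda>i. slice d i c) [0..<t]) = c"
proof -
  have "concat (map (\<lambda>i. slice d i c) [0..<s]) = take (offs d s) c" for s
    by (induction s) (simp_all add: slice_def take_add offs_def)
  then show ?thesis
    using assms by simp
qed

lemma length_concat_offs:
  assumes "length cs = t" "\<And>i. i < t \<Longrightarrow> length (cs ! i) = d i"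
  shows "length (concat cs) = offs d t"
proof -
  have "map length cs = map d [0..<t]"
    using assms by (auto intro!: nth_equalityI)
  then show ?thesis
    by (simp add: length_concat offs_def sum_list_sum_nth atLeast0LessThan)
qed

lemma slice_concat:
  assumes "length cs = t" "\<And>i. i < t \<Longrightarrow> length (cs ! i) = d i" "i < t"
  shows "slice d i (concat cs) = cs ! i"
proof -
  have cs: "cs = take i cs @ cs ! i # drop (Suc i) cs"
    using assms by (simp add: id_take_nth_drop)
  have "length (concat (take i cs)) = offs d i"
    by (rule length_concat_offs) (use assms in auto)
  moreover have "concat cs = concat (take i cs) @ cs ! i @ concat (drop (Suc i) cs)"
    by (subst cs) simp
  ultimately show ?thesis
    using assms by (simp add: slice_def)
qed

text \<open>Because the factors have fixed lengths, the components of a concatenation can be read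
  off by cutting at the offsets.\<close>

lemma prodcode_iff:
  assumes "\<And>i. i < t \<Longrightarrow> Cs i \<subseteq> vecs F (d i)"
  shows "c \<in> prodcode t Cs \<longleftrightarrow> length c = offs d t \<and> (\<forall>i<t. slice d i c \<in> Cs i)"
proof
  assume "c \<in> prodcode t Cs"
  then obtain cs where cs: "c = concat cs" "length cs = t" "\<forall>i<t. cs ! i \<in> Cs i"
    unfolding prodcode_def by blast
  have len: "length (cs ! i) = d i" if "i < t" for i
    using cs(3) assms[OF that] that vecs_length by blast
  show "length c = offs d t \<and> (\<forall>i<t. slice d i c \<in> Cs i)"
    using slice_concat[of cs t d] length_concat_offs[of cs t d] cs len by auto
next
  assume *: "length c = offs d t \<and> (\<forall>i<t. slice d i c \<in> Cs i)"
  then have "c = concat (map (\<lambda>i. slice d i c) [0..<t])"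
    using concat_slices by metis
  then show "c \<in> prodcode t Cs"
    unfolding prodcode_def mem_Collect_eq using *
    by (intro exI[of _ "map (\<lambda>i. slice d i c) [0..<t]"]) auto
qed

lemma slice_vadd:
  assumes "i < t" "length v = offs d t" "length w = offs d t"
  shows "slice d i (vadd v w) = vadd (slice d i v) (slice d i w)"
  using assms offs_add_le[OF assms(1), of d]
  by (auto intro!: nth_equalityI simp: length_slice[OF assms(1)] nth_slice[OF assms(1)])

lemma slice_smult: "slice d i (smult a v) = smult a (slice d i v)"
  by (simp add: slice_def smult_def take_map drop_map)

lemma slice_zvec:
  assumes "i < t"
  shows "slice d i (zvec (offs d t)) = zvec (d i)"
  using assms offs_add_le[OF assms(1), of d]
  by (auto intro!: nth_equalityI simp: length_slice[OF assms(1)] nth_slice[OF assms(1)])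

lemma fsubspace_prodcode:
  assumes W: "\<And>i. i < t \<Longrightarrow> fsubspace F (d i) (Ws i)"
  shows "fsubspace F (offs d t) (prodcode t Ws)"
proof -
  have iff: "c \<in> prodcode t Ws \<longleftrightarrow> length c = offs d t \<and> (\<forall>i<t. slice d i c \<in> Ws i)" for c
    by (rule prodcode_iff) (use W fsubspaceD(1) in blast)
  have "prodcode t Ws \<subseteq> vecs F (offs d t)"
  proof
    fix c assume c: "c \<in> prodcode t Ws"
    then obtain cs where cs: "c = concat cs" "length cs = t" "\<forall>i<t. cs ! i \<in> Ws i"
      unfolding prodcode_def by blast
    have "set (cs ! i) \<subseteq> F" if "i < t" for i
      using cs(3) fsubspaceD(1)[OF W[OF that]] that unfolding vecs_def by blast
    then have "set c \<subseteq> F"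
      using cs(1,2) by (fastforce simp: in_set_conv_nth)
    then show "c \<in> vecs F (offs d t)"
      using c iff by (simp add: vecs_def)
  qed
  then show ?thesis
    unfolding fsubspace_def
    by (auto simp: iff slice_vadd[of _ t] slice_smult slice_zvec fsubspaceD(2-4)[OF W])
qed

text \<open>The graded pieces of the filtration of \<open>W\<close> by the number of leading zero blocks.\<close>

definition block :: "(nat \<Rightarrow> nat) \<Rightarrow> 'a::field list set \<Rightarrow> nat \<Rightarrow> 'a list set" where
  "block d W i = slice d i ` {w \<in> W. \<forall>j<offs d i. w ! j = 0}"

lemma fsubspace_block:
  assumes W: "fsubspace F (offs d t) W" and i: "i < t"
  shows "fsubspace F (d i) (block d W i)"
proof -
  note WD = fsubspaceD[OF W]
  let ?W = "{w \<in> W. \<forall>j<offs d i. w ! j = 0}"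
  have le: "offs d i \<le> offs d t"
    using offs_mono i by simp
  have "block d W i \<subseteq> vecs F (d i)"
  proof
    fix x assume "x \<in> block d W i"
    then obtain w where w: "w \<in> W" "x = slice d i w"
      unfolding block_def by blast
    then have "length x = d i"
      using length_slice[OF i WD(5)] by blast
    moreover have "set x \<subseteq> set w"
      unfolding w(2) slice_def by (meson set_take_subset set_drop_subset subset_trans)
    ultimately show "x \<in> vecs F (d i)"
      using w WD(1) unfolding vecs_def by blast
  qed
  moreover have "zvec (d i) \<in> block d W i"
    unfolding block_def
    by (rule image_eqI[of _ _ "zvec (offs d t)"]) (use WD(2) le in \<open>auto simp: slice_zvec[OF i]\<close>)
  moreover have "vadd (slice d i v) (slice d i w) \<in> block d W i" if "v \<in> ?W" "w \<in> ?W" for v w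
    unfolding block_def
    by (rule image_eqI[of _ _ "vadd v w"])
      (use that WD(3)[of v w] WD(5)[of v] WD(5)[of w] le slice_vadd[OF i, of v d w] in auto)
  moreover have "smult a (slice d i v) \<in> block d W i" if "a \<in> F" "v \<in> ?W" for a v
    unfolding block_def
    by (rule image_eqI[of _ _ "smult a v"])
      (use that WD(4)[of a v] WD(5)[of v] le slice_smult[of d i a v] in auto)
  ultimately show ?thesis
    unfolding fsubspace_def block_def by blast
qed

text \<open>A vector whose first nonzero entry lies in block \<open>i\<close> vanishes on all
  earlier blocks. Its slice is therefore in the graded piece and has the same leading position, up
  to the offset.\<close>

lemma pivots_block:
  assumes W: "fsubspace F (offs d t) W" and i: "i < t"
  shows "pivots W \<inter> {offs d i..<offs d (Suc i)} = (+) (offs d i) ` pivots (block d W i)"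
proof -
  note WD = fsubspaceD[OF W]
  have le: "offs d i + d i \<le> offs d t"
    using offs_add_le i by simp
  show ?thesis
  proof (intro equalityI subsetI)
    fix p assume p: "p \<in> pivots W \<inter> {offs d i..<offs d (Suc i)}"
    then obtain w where w: "w \<in> W" "w ! p \<noteq> 0" "\<forall>j<p. w ! j = 0"
      unfolding pivots_def by blast
    define q where "q = p - offs d i"
    have q: "p = offs d i + q" "q < d i"
      using p by (auto simp: q_def)
    have len: "length (slice d i w) = d i"
      using length_slice[OF i WD(5)[OF w(1)]] .
    have "slice d i w \<in> block d W i"
      unfolding block_def using w q by (intro imageI) auto
    moreover have "slice d i w ! q \<noteq> 0" "\<forall>j<q. slice d i w ! j = 0"
      using w q by (auto simp: nth_slice[OF i WD(5)[OF w(1)]])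
    ultimately have "q \<in> pivots (block d W i)"
      unfolding pivots_def mem_Collect_eq using len q(2) by (intro bexI[of _ "slice d i w"]) auto
    then show "p \<in> (+) (offs d i) ` pivots (block d W i)"
      using q by blast
  next
    fix p assume "p \<in> (+) (offs d i) ` pivots (block d W i)"
    then obtain q w where q: "p = offs d i + q" and w: "w \<in> W" "\<forall>j<offs d i. w ! j = 0"
      and s: "q < length (slice d i w)" "slice d i w ! q \<noteq> 0" "\<forall>j<q. slice d i w ! j = 0"
      unfolding pivots_def block_def by blast
    have lw: "length w = offs d t"
      using WD(5) w by blast
    have qd: "q < d i"
      using s length_slice[OF i lw] by simp
    have "w ! j = 0" if "j < p" for j
    proof (cases "j < offs d i")
      case False
      then have "j - offs d i < q" "j = offs d i + (j - offs d i)"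
        using that q by auto
      then show ?thesis
        using s(3) qd nth_slice[OF i lw] by (metis order_less_trans)
    qed (use w in blast)
    moreover have "w ! p \<noteq> 0"
      using s(2) qd by (simp add: nth_slice[OF i lw] q)
    ultimately have "p \<in> pivots W"
      unfolding pivots_def mem_Collect_eq using w(1) lw le q qd by (intro bexI[of _ w]) auto
    then show "p \<in> pivots W \<inter> {offs d i..<offs d (Suc i)}"
      using q qd by auto
  qed
qed

text \<open>The blocks partition the positions, so the pivots are counted block by block. This is
  additivity of dimension along the filtration.\<close>

lemma fdim_blocks:
  assumes F: "subfield F" and W: "fsubspace F (offs d t) W"
  shows "fdim F (offs d t) W = (\<Sum>i<t. fdim F (d i) (block d W i))"
proof -
  let ?Q = "pivots W"
  have fin: "finite ?Q"
    using finite_pivots[OF fsubspaceD(1)[OF W]] .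
  have "card (?Q \<inter> {..<offs d s}) = (\<Sum>i<s. card (?Q \<inter> {offs d i..<offs d (Suc i)}))" for s
  proof (induction s)
    case 0
    then show ?case by (simp add: offs_def)
  next
    case (Suc s)
    have "?Q \<inter> {..<offs d (Suc s)} = (?Q \<inter> {..<offs d s}) \<union> (?Q \<inter> {offs d s..<offs d (Suc s)})"
      by auto
    moreover have "card \<dots> = card (?Q \<inter> {..<offs d s}) + card (?Q \<inter> {offs d s..<offs d (Suc s)})"
      by (rule card_Un_disjoint) (use fin in auto)
    ultimately show ?case
      using Suc by simp
  qed
  moreover have "?Q \<inter> {..<offs d t} = ?Q"
    using pivots_subset[OF fsubspaceD(1)[OF W]] by blast
  ultimately have "card ?Q = (\<Sum>i<t. card (?Q \<inter> {offs d i..<offs d (Suc i)}))"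
    by metis
  also have "\<dots> = (\<Sum>i<t. fdim F (d i) (block d W i))"
  proof (rule sum.cong[OF refl])
    fix i assume "i \<in> {..<t}"
    then have i: "i < t" by simp
    show "card (?Q \<inter> {offs d i..<offs d (Suc i)}) = fdim F (d i) (block d W i)"
      unfolding pivots_block[OF W i] fdim_eq_card_pivots[OF F fsubspace_block[OF W i]]
      by (rule card_image) auto
  qed
  finally show ?thesis
    by (simp add: fdim_eq_card_pivots[OF F W])
qed

lemma block_prodcode:
  assumes W: "\<And>i. i < t \<Longrightarrow> fsubspace F (d i) (Ws i)" and i: "i < t"
  shows "block d (prodcode t Ws) i = Ws i"
proof -
  have iff: "c \<in> prodcode t Ws \<longleftrightarrow> length c = offs d t \<and> (\<forall>i<t. slice d i c \<in> Ws i)" for c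
    by (rule prodcode_iff) (use W fsubspaceD(1) in blast)
  show ?thesis
  proof (intro equalityI subsetI)
    fix x assume "x \<in> block d (prodcode t Ws) i"
    then show "x \<in> Ws i"
      unfolding block_def using iff i by auto
  next
    fix x assume x: "x \<in> Ws i"
    have lx: "length x = d i"
      using fsubspaceD(5)[OF W[OF i] x] .
    \<comment> \<open>Padding with zeros places \<open>x\<close> in block \<open>i\<close>. The
      result lies in the product because every factor contains its zero vector.\<close>
    define c where "c = replicate (offs d i) 0 @ x @ replicate (offs d t - offs d (Suc i)) 0"
    have lc: "length c = offs d t"
      using offs_add_le[OF i, of d] by (simp add: c_def lx)
    have slice_i: "slice d i c = x"
      by (simp add: slice_def c_def lx)
    have slice_other: "slice d l c = zvec (d l)" if l: "l < t" "l \<noteq> i" for l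
    proof (rule nth_equalityI)
      show "length (slice d l c) = length (zvec (d l) :: 'a list)"
        by (simp add: length_slice[OF l(1) lc])
      fix j assume "j < length (slice d l c)"
      then have j: "j < d l"
        by (simp add: length_slice[OF l(1) lc])
      \<comment> \<open>A position of another block lies entirely to the left or entirely to the
        right of block \<open>i\<close>, where \<open>c\<close> was padded.\<close>
      have "offs d l + j < offs d i \<or> offs d (Suc i) \<le> offs d l + j"
        using l(2) offs_add_le[of l i d] offs_mono[of "Suc i" l d] j by (cases "l < i") auto
      moreover have "offs d l + j < offs d t"
        using offs_add_le[OF l(1), of d] j by simp
      ultimately have "c ! (offs d l + j) = 0"
        by (auto simp: c_def nth_append lx)
      then show "slice d l c ! j = zvec (d l) ! j"
        using j by (simp add: nth_slice[OF l(1) lc])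
    qed
    have "slice d l c \<in> Ws l" if "l < t" for l
      using that x slice_i slice_other[OF that] fsubspaceD(2)[OF W[OF that]] by (cases "l = i") auto
    then have "c \<in> prodcode t Ws"
      using iff lc by blast
    moreover have "\<forall>j<offs d i. c ! j = 0"
      by (simp add: c_def nth_append)
    ultimately show "x \<in> block d (prodcode t Ws) i"
      unfolding block_def using slice_i by blast
  qed
qed

lemma fdim_prodcode:
  assumes F: "subfield F" and W: "\<And>i. i < t \<Longrightarrow> fsubspace F (d i) (Ws i)"
  shows "fdim F (offs d t) (prodcode t Ws) = (\<Sum>i<t. fdim F (d i) (Ws i))"
  using fdim_blocks[OF F fsubspace_prodcode[OF W]] block_prodcode[OF W] by simp

section \<open>Generalized rank weights\<close>

locale finite_extension =
  fixes K :: "'a::field set" and B :: "'a list"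
  assumes K: "subfield K" and B: "field_basis K B"
begin

lemma coords_props:
  shows "length (coords K B x) = length B" "set (coords K B x) \<subseteq> K"
    "x = (\<Sum>l<length B. coords K B x ! l * B ! l)"
proof -
  have "\<exists>!ks. length ks = length B \<and> set ks \<subseteq> K \<and> x = (\<Sum>l<length B. ks ! l * B ! l)"
    using B unfolding field_basis_def by blast
  from theI'[OF this] show "length (coords K B x) = length B" "set (coords K B x) \<subseteq> K"
    "x = (\<Sum>l<length B. coords K B x ! l * B ! l)"
    unfolding coords_def by blast+
qed

lemma coords_nth_in: "l < length B \<Longrightarrow> coords K B x ! l \<in> K"
  using coords_props(1,2)[of x] by (metis nth_mem subsetD)

lemma coords_eqI:
  assumes "length ks = length B" "set ks \<subseteq> K" "x = (\<Sum>l<length B. ks ! l * B ! l)"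
  shows "coords K B x = ks"
proof -
  have "\<exists>!ks. length ks = length B \<and> set ks \<subseteq> K \<and> x = (\<Sum>l<length B. ks ! l * B ! l)"
    using B unfolding field_basis_def by (rule spec)
  then show ?thesis
    unfolding coords_def by (rule the1_equality) (intro conjI assms)
qed

text \<open>Linearity of the coordinates over \<open>K\<close>, by their uniqueness. The form with
  scalars on the right matches the entries of a product \<open>c P\<close> with \<open>P\<close>
  over \<open>K\<close>.\<close>

lemma coords_sum:
  assumes k: "\<And>j. j \<in> J \<Longrightarrow> k j \<in> K" and l: "l < length B"
  shows "coords K B (\<Sum>j\<in>J. x j * k j) ! l = (\<Sum>j\<in>J. coords K B (x j) ! l * k j)"
proof -
  define ks where "ks = map (\<lambda>l. \<Sum>j\<in>J. coords K B (x j) ! l * k j) [0..<length B]"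
  have "coords K B (\<Sum>j\<in>J. x j * k j) = ks"
  proof (rule coords_eqI)
    show "length ks = length B"
      by (simp add: ks_def)
    show "set ks \<subseteq> K"
      unfolding ks_def
      by (auto intro!: subfield_sum[OF K] subfieldD(4)[OF K] coords_nth_in k)
    have "(\<Sum>j\<in>J. x j * k j) = (\<Sum>j\<in>J. (\<Sum>l<length B. coords K B (x j) ! l * B ! l) * k j)"
      using coords_props(3) by (intro sum.cong) auto
    also have "\<dots> = (\<Sum>l<length B. \<Sum>j\<in>J. coords K B (x j) ! l * B ! l * k j)"
      by (simp add: sum_distrib_right) (rule sum.swap)
    also have "\<dots> = (\<Sum>l<length B. ks ! l * B ! l)"
      by (intro sum.cong) (auto simp: ks_def sum_distrib_right sum_distrib_left ac_simps)
    finally show "(\<Sum>j\<in>J. x j * k j) = (\<Sum>l<length B. ks ! l * B ! l)" .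
  qed
  then show ?thesis
    using l by (simp add: ks_def)
qed

lemma coords_zero: "l < length B \<Longrightarrow> coords K B 0 ! l = 0"
  \<comment> \<open>The empty sum: over an empty index set the summands and scalars are arbitrary,
    hence \<open>undefined\<close>.\<close>
  using coords_sum[of "{}" undefined l undefined] by simp

lemma eq_zero_of_coords:
  assumes "\<And>l. l < length B \<Longrightarrow> coords K B x ! l = 0"
  shows "x = 0"
proof -
  have "(\<Sum>l<length B. coords K B x ! l * B ! l) = 0"
    using assms by (intro sum.neutral) auto
  then show ?thesis
    using coords_props(3)[of x] by (rule trans[rotated])
qed

text \<open>The row of index \<open>l\<close> of the coordinate matrix \<open>M_B(c)\<close>; these
  rows generate the rank support.\<close>

definition crow :: "nat \<Rightarrow> 'a list \<Rightarrow> 'a list" where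
  "crow l c = map (\<lambda>x. coords K B x ! l) c"

lemma length_crow [simp]: "length (crow l c) = length c"
  by (simp add: crow_def)

lemma nth_crow [simp]: "j < length c \<Longrightarrow> crow l c ! j = coords K B (c ! j) ! l"
  by (simp add: crow_def)

lemma crow_in_vecs: "l < length B \<Longrightarrow> length c = n \<Longrightarrow> crow l c \<in> vecs K n"
  by (simp add: vecs_iff_nth coords_nth_in)

text \<open>The entries of \<open>P\<close> are scalars in \<open>K\<close>, through which
  coordinates pass: \<open>M_B(c P) = M_B(c) P\<close>, read row by row.\<close>

lemma crow_lincomb:
  assumes l: "l < length B" and c: "length c = length P" and P: "set P \<subseteq> vecs K n"
  shows "crow l (lincomb n c P) = lincomb n (crow l c) P"
proof -
  have len: "\<And>p. p \<in> set P \<Longrightarrow> length p = n"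
    using P vecs_length by blast
  show ?thesis
  proof (rule nth_equalityI)
    show "length (crow l (lincomb n c P)) = length (lincomb n (crow l c) P)"
      using len by (simp add: length_lincomb)
    fix j assume "j < length (crow l (lincomb n c P))"
    then have j: "j < n"
      using len by (simp add: length_lincomb)
    have "crow l (lincomb n c P) ! j = coords K B (\<Sum>x<length P. c ! x * P ! x ! j) ! l"
      using j len c by (simp add: length_lincomb nth_lincomb)
    also have "\<dots> = (\<Sum>x<length P. coords K B (c ! x) ! l * P ! x ! j)"
    proof (rule coords_sum[OF _ l])
      fix x assume "x \<in> {..<length P}"
      then have "P ! x \<in> vecs K n"
        using P by auto
      then show "P ! x ! j \<in> K"
        using j by (simp add: vecs_iff_nth)
    qed
    also have "\<dots> = lincomb n (crow l c) P ! j"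
      using j len c by (simp add: nth_lincomb)
    finally show "crow l (lincomb n c P) ! j = lincomb n (crow l c) P ! j" .
  qed
qed

text \<open>Taking coordinates of the coefficients splits a relation over the large field into
  relations over \<open>K\<close>, one for each element of \<open>B\<close>.\<close>

lemma lin_indep_extend:
  assumes P: "set P \<subseteq> vecs K n" and ind: "lin_indep K n P"
  shows "lin_indep UNIV n P"
  unfolding lin_indep_def
proof (intro allI impI)
  fix as assume as: "length as = length P \<and> set as \<subseteq> UNIV \<and> lincomb n as P = zvec n"
  have 0: "coords K B (as ! j) ! l = 0" if l: "l < length B" and j: "j < length P" for l j
  proof -
    have "lincomb n (crow l as) P = crow l (zvec n)"
      using crow_lincomb[OF l _ P] as by metis
    also have "\<dots> = zvec n"
      using coords_zero[OF l] by (auto intro!: nth_equalityI)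
    finally have "lincomb n (crow l as) P = zvec n" .
    moreover have "crow l as \<in> vecs K (length P)"
      using crow_in_vecs[OF l] as by blast
    ultimately have "set (crow l as) \<subseteq> {0}"
      using ind unfolding lin_indep_def vecs_def by blast
    moreover have "crow l as ! j \<in> set (crow l as)"
      using as j by (intro nth_mem) simp
    ultimately show ?thesis
      using as j by auto
  qed
  show "set as \<subseteq> {0}"
  proof
    fix x assume "x \<in> set as"
    then obtain j where "j < length P" "x = as ! j"
      using as by (auto simp: in_set_conv_nth)
    then show "x \<in> {0}"
      using eq_zero_of_coords[of x] 0 by simp
  qed
qed

section \<open>Rank supports\<close>

lemma Rsupp_eq: "Rsupp K B n c = fspan K n ((\<lambda>l. crow l c) ` {..<length B})"
  unfolding Rsupp_def crow_def by (rule arg_cong[of _ _ "fspan K n"]) auto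

text \<open>Flattens the nested span of the definition into the span of all coordinate rows, so that
  later inclusions can be checked on single rows.\<close>

lemma RsuppD_eq:
  assumes D: "D \<subseteq> vecs UNIV n"
  shows "RsuppD K B n D = fspan K n {crow l c | l c. l < length B \<and> c \<in> D}" (is "_ = fspan K n ?S")
proof
  have S: "?S \<subseteq> vecs K n"
    using crow_in_vecs vecs_length D by blast
  show "RsuppD K B n D \<subseteq> fspan K n ?S"
    unfolding RsuppD_def
  proof (rule fspan_least[OF fspan_fsubspace[OF K S]])
    have "Rsupp K B n c \<subseteq> fspan K n ?S" if "c \<in> D" for c
      unfolding Rsupp_eq by (rule fspan_mono) (use that in auto)
    then show "(\<Union>d\<in>D. Rsupp K B n d) \<subseteq> fspan K n ?S"
      by blast
  qed
  have "crow l c \<in> Rsupp K B n c" if "l < length B" "c \<in> D" for l c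
  proof -
    have "(\<lambda>l. crow l c) ` {..<length B} \<subseteq> vecs K n"
      using crow_in_vecs vecs_length D that by blast
    from fspan_superset[OF K this] show ?thesis
      unfolding Rsupp_eq using that by blast
  qed
  then show "fspan K n ?S \<subseteq> RsuppD K B n D"
    unfolding RsuppD_def by (intro fspan_mono) blast
qed

lemma RsuppD_fsubspace:
  assumes D: "D \<subseteq> vecs UNIV n"
  shows "fsubspace K n (RsuppD K B n D)"
  unfolding RsuppD_eq[OF D] by (rule fspan_fsubspace[OF K]) (use crow_in_vecs vecs_length D in blast)

lemma RsuppD_least:
  assumes W: "fsubspace K n W" and D: "D \<subseteq> vecs UNIV n"
    and "\<And>l c. l < length B \<Longrightarrow> c \<in> D \<Longrightarrow> crow l c \<in> W"
  shows "RsuppD K B n D \<subseteq> W"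
  unfolding RsuppD_eq[OF D] by (rule fspan_least[OF W]) (use assms(3) in blast)

lemma crow_in_RsuppD:
  assumes D: "D \<subseteq> vecs UNIV n" and "l < length B" "c \<in> D"
  shows "crow l c \<in> RsuppD K B n D"
proof -
  have "{crow l c | l c. l < length B \<and> c \<in> D} \<subseteq> vecs K n"
    using crow_in_vecs vecs_length D by blast
  from fspan_superset[OF K this] show ?thesis
    unfolding RsuppD_eq[OF D] using assms(2,3) by blast
qed

section \<open>Rank weights and their minima\<close>

lemma wtR_le:
  assumes "fsubspace UNIV n D"
  shows "wtR K B n D \<le> n"
  unfolding wtR_def by (rule fdim_le[OF K RsuppD_fsubspace[OF fsubspaceD(1)[OF assms]]])

text \<open>The coordinates of \<open>0\<close> are all \<open>0\<close>, so positions at which all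
  of \<open>D\<close> vanishes stay zero throughout its rank support.\<close>

lemma wtR_le_of_vanishing:
  assumes D: "fsubspace UNIV n D" and 0: "\<And>c i. c \<in> D \<Longrightarrow> i < j \<Longrightarrow> i < n \<Longrightarrow> c ! i = 0"
  shows "wtR K B n D \<le> n - j"
proof -
  note lenD = fsubspaceD(5)[OF D]
  define W where "W = {v \<in> vecs K n. \<forall>i<j. i < n \<longrightarrow> v ! i = 0}"
  have W: "fsubspace K n W"
    unfolding fsubspace_def W_def
    by (auto simp: vecs_iff_nth subfieldD(1,3,4)[OF K])
  have "RsuppD K B n D \<subseteq> W"
    by (rule RsuppD_least[OF W fsubspaceD(1)[OF D]])
      (auto simp: W_def crow_in_vecs lenD 0 coords_zero)
  then have "wtR K B n D \<le> fdim K n W"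
    unfolding wtR_def by (intro fdim_mono[OF K RsuppD_fsubspace[OF fsubspaceD(1)[OF D]] W])
  also have "fdim K n W \<le> n - j"
    by (rule fdim_le_of_vanishing[OF K W]) (simp add: W_def)
  finally show ?thesis .
qed

lemma grw_le:
  assumes "fsubspace UNIV n D" "D \<subseteq> C"
  shows "grw K B n C (fdim UNIV n D) \<le> wtR K B n D"
proof (cases "fdim UNIV n D = 0")
  case False
  let ?S = "{wtR K B n D' | D'. fsubspace UNIV n D' \<and> D' \<subseteq> C \<and> fdim UNIV n D' = fdim UNIV n D}"
  \<comment> \<open>Weights are bounded by the length, so \<open>Min\<close> is taken over a finite
    set however many subcodes there are.\<close>
  have "?S \<subseteq> {..n}"
    using wtR_le by auto
  then have "finite ?S"
    using finite_subset by blast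
  then have "Min ?S \<le> wtR K B n D"
    by (rule Min_le) (use assms in blast)
  then show ?thesis
    using False by (simp add: grw_def)
qed (simp add: grw_def)

text \<open>The case \<open>r = 0\<close> is included so that blocks with a zero share can be
  treated like the others.\<close>

lemma grw_attained:
  assumes C: "fsubspace UNIV n C" and r: "r \<le> fdim UNIV n C"
  obtains D where "fsubspace UNIV n D" "D \<subseteq> C" "fdim UNIV n D = r" "wtR K B n D = grw K B n C r"
proof -
  obtain D0 where D0: "fsubspace UNIV n D0" "D0 \<subseteq> C" "fdim UNIV n D0 = r"
    using exists_subspace_fdim_vanishing[OF subfield_UNIV C r] by blast
  show thesis
  proof (cases "r = 0")
    case True
    \<comment> \<open>Vanishing at all \<open>n\<close> positions gives weight \<open>0\<close>, in
      agreement with the convention for \<open>r = 0\<close>.\<close>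
    have "wtR K B n {zvec n} \<le> n - n"
      by (rule wtR_le_of_vanishing[OF fsubspace_zero[OF subfield_UNIV]]) auto
    then show thesis
      using that[OF fsubspace_zero[OF subfield_UNIV]] fdim_zero[OF subfield_UNIV, of n]
        fsubspaceD(2)[OF C] True
      by (simp add: grw_def)
  next
    case False
    let ?S = "{wtR K B n D' | D'. fsubspace UNIV n D' \<and> D' \<subseteq> C \<and> fdim UNIV n D' = r}"
    have "?S \<subseteq> {..n}"
      using wtR_le by auto
    then have "finite ?S"
      using finite_subset by blast
    moreover have "?S \<noteq> {}"
      using D0 by blast
    ultimately have "Min ?S \<in> ?S"
      by (rule Min_in)
    then show thesis
      using that False by (auto simp: grw_def)
  qed
qed

lemma grw_singleton_bound:
  assumes C: "fsubspace UNIV n C" and r: "r \<le> fdim UNIV n C"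
  shows "grw K B n C r \<le> n - fdim UNIV n C + r"
proof -
  obtain D j where D: "fsubspace UNIV n D" "D \<subseteq> C" "fdim UNIV n D = r" "fdim UNIV n C \<le> j + r"
      "\<forall>c\<in>D. \<forall>i<j. i < n \<longrightarrow> c ! i = 0"
    using exists_subspace_fdim_vanishing[OF subfield_UNIV C r] by blast
  have "grw K B n C r \<le> wtR K B n D"
    using grw_le[OF D(1,2)] D(3) by simp
  also have "\<dots> \<le> n - j"
    by (rule wtR_le_of_vanishing[OF D(1)]) (use D(5) in blast)
  also have "\<dots> \<le> n - fdim UNIV n C + r"
    using D(4) fdim_le[OF subfield_UNIV C] by linarith
  finally show ?thesis .
qed

section \<open>Multiplication by a matrix over the base field with independent rows\<close>

context
  fixes P :: "'a list list" and n :: nat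
  assumes P: "set P \<subseteq> vecs K n" and ind: "lin_indep K n P"
begin

lemma basis_length: "p \<in> set P \<Longrightarrow> length p = n"
  using P vecs_length by blast

lemma basis_UNIV: "set P \<subseteq> vecs UNIV n"
  using basis_length by (auto simp: vecs_def)

lemma inj_on_UNIV: "inj_on (\<lambda>c. lincomb n c P) (vecs UNIV (length P))"
  by (rule lin_indep_inj_on[OF subfield_UNIV basis_length lin_indep_extend[OF P ind]])

lemma fdim_UNIV_image:
  assumes "fsubspace UNIV (length P) D"
  shows "fdim UNIV n ((\<lambda>c. lincomb n c P) ` D) = fdim UNIV (length P) D"
  using basis_length assms inj_on_subset[OF inj_on_UNIV fsubspaceD(1)[OF assms]]
  by (rule fdim_lincomb_image)

text \<open>The coordinate rows of the image are the images of the coordinate rows, so the rank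
  support is mapped onto the rank support. Injectivity over \<open>K\<close> then preserves its
  dimension.\<close>

lemma wtR_image:
  assumes D: "fsubspace UNIV (length P) D"
  shows "wtR K B n ((\<lambda>c. lincomb n c P) ` D) = wtR K B (length P) D"
proof -
  let ?f = "\<lambda>c. lincomb n c P"
  note lenD = fsubspaceD(5)[OF D]
  let ?S = "{crow l c | l c. l < length B \<and> c \<in> D}"
  have "{crow l c | l c. l < length B \<and> c \<in> ?f ` D} = {crow l (?f c) | l c. l < length B \<and> c \<in> D}"
    by blast
  also have "\<dots> = {?f (crow l c) | l c. l < length B \<and> c \<in> D}"
    using crow_lincomb[OF _ lenD P] by metis
  also have "\<dots> = ?f ` ?S"
    by blast
  finally have rows: "{crow l c | l c. l < length B \<and> c \<in> ?f ` D} = ?f ` ?S" .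
  have "RsuppD K B n (?f ` D) = fspan K n (?f ` ?S)"
    unfolding rows[symmetric] 
    by (rule RsuppD_eq[OF fsubspaceD(1)[OF fsubspace_lincomb_image[OF basis_UNIV subfield_UNIV D]]])
  also have "\<dots> = ?f ` fspan K (length P) ?S"
    by (rule fspan_lincomb_image[symmetric, OF basis_length]) (use lenD in auto)
  also have "\<dots> = ?f ` RsuppD K B (length P) D"
    using RsuppD_eq[OF fsubspaceD(1)[OF D]] by simp
  finally have eq: "RsuppD K B n (?f ` D) = ?f ` RsuppD K B (length P) D" .
  note R = RsuppD_fsubspace[OF fsubspaceD(1)[OF D]]
  have "inj_on ?f (RsuppD K B (length P) D)"
    using inj_on_subset[OF lin_indep_inj_on[OF K basis_length ind] fsubspaceD(1)[OF R]] .
  with basis_length R show ?thesis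
    unfolding wtR_def eq by (rule fdim_lincomb_image)
qed

text \<open>Subcodes of \<open>A\<close> and of its image correspond with equal dimension and
  weight, so both minima range over the same set of numbers.\<close>

lemma grw_image:
  assumes A: "fsubspace UNIV (length P) A"
  shows "grw K B n ((\<lambda>c. lincomb n c P) ` A) r = grw K B (length P) A r"
proof -
  let ?f = "\<lambda>c. lincomb n c P"
  have "{wtR K B n D | D. fsubspace UNIV n D \<and> D \<subseteq> ?f ` A \<and> fdim UNIV n D = r}
      = {wtR K B (length P) D | D. fsubspace UNIV (length P) D \<and> D \<subseteq> A \<and> fdim UNIV (length P) D = r}"
    (is "?X = ?Y")
  proof (intro equalityI subsetI)
    fix x assume "x \<in> ?X"
    then obtain D where D: "x = wtR K B n D" "fsubspace UNIV n D" "D \<subseteq> ?f ` A" "fdim UNIV n D = r"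
      by blast
    \<comment> \<open>The preimage of \<open>D\<close> inside \<open>A\<close>; it maps onto
      \<open>D\<close> because \<open>D\<close> lies in the image of \<open>A\<close>.\<close>
    define E where "E = A \<inter> {c \<in> vecs UNIV (length P). ?f c \<in> D}"
    have E: "fsubspace UNIV (length P) E"
      unfolding E_def
      by (intro fsubspace_Int[OF A] fsubspace_lincomb_vimage[OF subfield_UNIV basis_UNIV D(2)])
    have "D = ?f ` E"
      using D(3) fsubspaceD(1)[OF A] by (auto simp: E_def)
    then have "x = wtR K B (length P) E" "fdim UNIV (length P) E = r"
      using D wtR_image[OF E] fdim_UNIV_image[OF E] by auto
    moreover have "E \<subseteq> A"
      by (auto simp: E_def)
    ultimately show "x \<in> ?Y"
      using E by blast
  next
    fix x assume "x \<in> ?Y"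
    then obtain D where D: "x = wtR K B (length P) D" "fsubspace UNIV (length P) D" "D \<subseteq> A"
        "fdim UNIV (length P) D = r"
      by blast
    have "x = wtR K B n (?f ` D)" "fdim UNIV n (?f ` D) = r"
      using D wtR_image fdim_UNIV_image by auto
    moreover have "fsubspace UNIV n (?f ` D)"
      by (rule fsubspace_lincomb_image[OF basis_UNIV subfield_UNIV D(2)])
    moreover have "?f ` D \<subseteq> ?f ` A"
      using D(3) by blast
    ultimately show "x \<in> ?X"
      by blast
  qed
  then show ?thesis
    unfolding grw_def by simp
qed

end

section \<open>Generalized rank weights of product codes\<close>

lemma slice_crow: "slice d i (crow l c) = crow l (slice d i c)"
  by (simp add: slice_def crow_def take_map drop_map)

text \<open>The rank support of a product lies in the product of the rank supports, whose dimension
  is the sum of theirs.\<close>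

lemma wtR_prodcode_le:
  assumes D: "\<And>i. i < t \<Longrightarrow> fsubspace UNIV (d i) (Ds i)"
  shows "wtR K B (offs d t) (prodcode t Ds) \<le> (\<Sum>i<t. wtR K B (d i) (Ds i))"
proof -
  let ?R = "\<lambda>i. RsuppD K B (d i) (Ds i)"
  have R: "fsubspace K (d i) (?R i)" if "i < t" for i
    by (rule RsuppD_fsubspace[OF fsubspaceD(1)[OF D[OF that]]])
  note lenP = fsubspaceD(1)[OF fsubspace_prodcode[OF D]]
  note RP = fsubspace_prodcode[OF R]
  have iffD: "c \<in> prodcode t Ds \<longleftrightarrow> length c = offs d t \<and> (\<forall>i<t. slice d i c \<in> Ds i)" for c
    by (rule prodcode_iff) (use D fsubspaceD(1) in blast)
  have iffR: "c \<in> prodcode t ?R \<longleftrightarrow> length c = offs d t \<and> (\<forall>i<t. slice d i c \<in> ?R i)" for c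
    by (rule prodcode_iff) (use R fsubspaceD(1) in blast)
  have "RsuppD K B (offs d t) (prodcode t Ds) \<subseteq> prodcode t ?R"
  proof (rule RsuppD_least[OF RP lenP])
    fix l c assume l: "l < length B" and c: "c \<in> prodcode t Ds"
    have "slice d i (crow l c) \<in> ?R i" if "i < t" for i
      unfolding slice_crow
      by (rule crow_in_RsuppD[OF fsubspaceD(1)[OF D[OF that]] l]) (use c iffD that in auto)
    then show "crow l c \<in> prodcode t ?R"
      using iffR c iffD by simp
  qed
  then have "wtR K B (offs d t) (prodcode t Ds) \<le> fdim K (offs d t) (prodcode t ?R)"
    unfolding wtR_def by (intro fdim_mono[OF K RsuppD_fsubspace[OF lenP] RP])
  also have "\<dots> = (\<Sum>i<t. wtR K B (d i) (Ds i))"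
    unfolding wtR_def by (rule fdim_prodcode[OF K R])
  finally show ?thesis .
qed

text \<open>Coordinate rows inherit leading zeros. Hence the support of a graded piece lies in the
  graded piece of the support, and the dimensions of the latter pieces add up to the weight of
  \<open>D\<close>.\<close>

lemma sum_wtR_block_le:
  assumes D: "fsubspace UNIV (offs d t) D"
  shows "(\<Sum>i<t. wtR K B (d i) (block d D i)) \<le> wtR K B (offs d t) D"
proof -
  let ?R = "RsuppD K B (offs d t) D"
  note lenD = fsubspaceD(1)[OF D]
  note R = RsuppD_fsubspace[OF lenD]
  have "wtR K B (d i) (block d D i) \<le> fdim K (d i) (block d ?R i)" if i: "i < t" for i
  proof -
    note lenb = fsubspaceD(1)[OF fsubspace_block[OF D i]]
    have "RsuppD K B (d i) (block d D i) \<subseteq> block d ?R i"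
    proof (rule RsuppD_least[OF fsubspace_block[OF R i] lenb])
      fix l c assume l: "l < length B" and "c \<in> block d D i"
      then obtain w where w: "c = slice d i w" "w \<in> D" "\<forall>j<offs d i. w ! j = 0"
        unfolding block_def by blast
      have "offs d i \<le> length w"
        using offs_mono[of i t d] i fsubspaceD(5)[OF D w(2)] by simp
      then have "\<forall>j<offs d i. crow l w ! j = 0"
        using w(3) l by (simp add: coords_zero)
      then have "slice d i (crow l w) \<in> block d ?R i"
        unfolding block_def using crow_in_RsuppD[OF lenD l w(2)] by blast
      then show "crow l c \<in> block d ?R i"
        by (simp add: w(1) slice_crow)
    qed
    then show ?thesis
      unfolding wtR_def
      by (intro fdim_mono[OF K RsuppD_fsubspace[OF lenb] fsubspace_block[OF R i]])
  qed
  then have "(\<Sum>i<t. wtR K B (d i) (block d D i)) \<le> (\<Sum>i<t. fdim K (d i) (block d ?R i))"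
    by (intro sum_mono) simp
  also have "\<dots> = wtR K B (offs d t) D"
    unfolding wtR_def by (rule fdim_blocks[OF K R, symmetric])
  finally show ?thesis .
qed

text \<open>The product of optimal subcodes of the factors is a competitor of the right
  dimension.\<close>

lemma grw_prodcode_le:
  assumes C: "\<And>i. i < t \<Longrightarrow> fsubspace UNIV (d i) (Cs i)"
    and r: "\<And>i. i < t \<Longrightarrow> rs i \<le> fdim UNIV (d i) (Cs i)"
  shows "grw K B (offs d t) (prodcode t Cs) (\<Sum>i<t. rs i) \<le> (\<Sum>i<t. grw K B (d i) (Cs i) (rs i))"
proof -
  have "\<forall>i\<in>{..<t}. \<exists>D. fsubspace UNIV (d i) D \<and> D \<subseteq> Cs i \<and> fdim UNIV (d i) D = rs i
      \<and> wtR K B (d i) D = grw K B (d i) (Cs i) (rs i)"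
    using grw_attained[OF C r] by (metis lessThan_iff)
  then obtain Ds where Ds: "\<And>i. i < t \<Longrightarrow> fsubspace UNIV (d i) (Ds i)"
      "\<And>i. i < t \<Longrightarrow> Ds i \<subseteq> Cs i" "\<And>i. i < t \<Longrightarrow> fdim UNIV (d i) (Ds i) = rs i"
      "\<And>i. i < t \<Longrightarrow> wtR K B (d i) (Ds i) = grw K B (d i) (Cs i) (rs i)"
    by (metis lessThan_iff)
  have PD: "fsubspace UNIV (offs d t) (prodcode t Ds)"
    using Ds(1) by (rule fsubspace_prodcode)
  have "prodcode t Ds \<subseteq> prodcode t Cs"
    unfolding prodcode_def using Ds(2) by blast
  moreover have "fdim UNIV (offs d t) (prodcode t Ds) = (\<Sum>i<t. rs i)"
    using fdim_prodcode[OF subfield_UNIV Ds(1)] Ds(3) by simp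
  ultimately have "grw K B (offs d t) (prodcode t Cs) (\<Sum>i<t. rs i)
      \<le> wtR K B (offs d t) (prodcode t Ds)"
    using grw_le[OF PD] by metis
  moreover have "wtR K B (offs d t) (prodcode t Ds) \<le> (\<Sum>i<t. wtR K B (d i) (Ds i))"
    using Ds(1) by (rule wtR_prodcode_le)
  moreover have "(\<Sum>i<t. wtR K B (d i) (Ds i)) = (\<Sum>i<t. grw K B (d i) (Cs i) (rs i))"
    using Ds(4) by (intro sum.cong) auto
  ultimately show ?thesis
    by simp
qed

text \<open>For an optimal subcode \<open>D\<close> of the product, which need not itself be a
  product, the shares are the dimensions of its graded pieces. They sum to \<open>r\<close> by
  \<open>fdim_blocks\<close> over the large field, and the weights are compared by
  \<open>sum_wtR_block_le\<close>.\<close>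

lemma grw_prodcode_ge:
  assumes C: "\<And>i. i < t \<Longrightarrow> fsubspace UNIV (d i) (Cs i)"
    and r: "r \<le> fdim UNIV (offs d t) (prodcode t Cs)"
  obtains rs where "\<And>i. i < t \<Longrightarrow> rs i \<le> fdim UNIV (d i) (Cs i)" "(\<Sum>i<t. rs i) = r"
    "(\<Sum>i<t. grw K B (d i) (Cs i) (rs i)) \<le> grw K B (offs d t) (prodcode t Cs) r"
proof -
  obtain D where D: "fsubspace UNIV (offs d t) D" "D \<subseteq> prodcode t Cs"
      "fdim UNIV (offs d t) D = r" "wtR K B (offs d t) D = grw K B (offs d t) (prodcode t Cs) r"
    using grw_attained[OF fsubspace_prodcode[OF C] r] by blast
  define rs where "rs i = fdim UNIV (d i) (block d D i)" for i
  have sub: "block d D i \<subseteq> Cs i" if "i < t" for i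
  proof -
    have "block d D i \<subseteq> block d (prodcode t Cs) i"
      unfolding block_def using D(2) by blast
    then show ?thesis
      using block_prodcode[OF C that] by simp
  qed
  show thesis
  proof
    show "rs i \<le> fdim UNIV (d i) (Cs i)" if "i < t" for i
      unfolding rs_def
      by (rule fdim_mono[OF subfield_UNIV fsubspace_block[OF D(1) that] C[OF that] sub[OF that]])
    show "(\<Sum>i<t. rs i) = r"
      using fdim_blocks[OF subfield_UNIV D(1)] D(3) by (simp add: rs_def)
    have "(\<Sum>i<t. grw K B (d i) (Cs i) (rs i)) \<le> (\<Sum>i<t. wtR K B (d i) (block d D i))"
      unfolding rs_def by (intro sum_mono grw_le) (use fsubspace_block[OF D(1)] sub in auto)
    also have "\<dots> \<le> wtR K B (offs d t) D"
      by (rule sum_wtR_block_le[OF D(1)])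
    finally show "(\<Sum>i<t. grw K B (d i) (Cs i) (rs i)) \<le> grw K B (offs d t) (prodcode t Cs) r"
      using D(4) by simp
  qed
qed


text \<open>Merges the two bounds into a minimum. Extensional functions on \<open>\<Lambda>\<close>
  keep the set of tuples finite, and blocks outside \<open>\<Lambda>\<close> can only have share
  zero.\<close>

lemma grw_prodcode_eq_Min:
  fixes t :: nat and d :: "nat \<Rightarrow> nat" and Cs :: "nat \<Rightarrow> 'a list set"
  assumes C: "\<And>i. i < t \<Longrightarrow> fsubspace UNIV (d i) (Cs i)"
    and r: "r \<le> fdim UNIV (offs d t) (prodcode t Cs)"
    and L: "\<Lambda> \<subseteq> {..<t}" and L0: "\<And>i. i < t \<Longrightarrow> i \<notin> \<Lambda> \<Longrightarrow> fdim UNIV (d i) (Cs i) = 0"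
    and kk: "\<And>i. i < t \<Longrightarrow> kk i = fdim UNIV (d i) (Cs i)"
  defines "R \<equiv> {rs. rs \<in> (\<Pi>\<^sub>E i\<in>\<Lambda>. {0..kk i}) \<and> (\<Sum>i\<in>\<Lambda>. rs i) = r}"
  shows "finite R" "R \<noteq> {}"
    "grw K B (offs d t) (prodcode t Cs) r = Min ((\<lambda>rs. \<Sum>i\<in>\<Lambda>. grw K B (d i) (Cs i) (rs i)) ` R)"
proof -
  let ?g = "\<lambda>rs. \<Sum>i\<in>\<Lambda>. grw K B (d i) (Cs i) (rs i)"
  have finL: "finite \<Lambda>"
    using L finite_subset by blast
  show fin: "finite R"
    unfolding R_def by (rule finite_subset[OF _ finite_PiE[OF finL, of "\<lambda>i. {0..kk i}"]]) auto
  have sum_L: "(\<Sum>i<t. f i) = (\<Sum>i\<in>\<Lambda>. f i)" if "\<And>i. i < t \<Longrightarrow> i \<notin> \<Lambda> \<Longrightarrow> f i = 0" for f :: "nat \<Rightarrow> nat"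
    by (rule sum.mono_neutral_right) (use L that in auto)
  have grw0: "grw K B m D 0 = 0" for m D
    by (simp add: grw_def)
  have upper: "grw K B (offs d t) (prodcode t Cs) r \<le> ?g rs" if rs: "rs \<in> R" for rs
  proof -
    \<comment> \<open>Extension by zero gives a tuple over all blocks; an added zero costs nothing
      by the convention for \<open>grw\<close>.\<close>
    define rs' where "rs' i = (if i \<in> \<Lambda> then rs i else 0)" for i
    have "(\<Sum>i<t. rs' i) = r"
      using sum_L[of rs'] rs by (simp add: rs'_def R_def)
    moreover have "rs' i \<le> fdim UNIV (d i) (Cs i)" if "i < t" for i
      using rs kk[OF that] by (auto simp: rs'_def R_def PiE_iff)
    ultimately have "grw K B (offs d t) (prodcode t Cs) r \<le> (\<Sum>i<t. grw K B (d i) (Cs i) (rs' i))"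
      using grw_prodcode_le[of t d Cs rs'] C by blast
    also have "\<dots> = ?g rs'"
      by (rule sum_L) (simp add: rs'_def grw0)
    also have "\<dots> = ?g rs"
      by (rule sum.cong) (auto simp: rs'_def)
    finally show ?thesis .
  qed
  obtain rs where rs: "\<And>i. i < t \<Longrightarrow> rs i \<le> fdim UNIV (d i) (Cs i)" "(\<Sum>i<t. rs i) = r"
      "(\<Sum>i<t. grw K B (d i) (Cs i) (rs i)) \<le> grw K B (offs d t) (prodcode t Cs) r"
    using grw_prodcode_ge[of t d Cs r] C r by blast
  have rs0: "rs i = 0" if "i < t" "i \<notin> \<Lambda>" for i
    using rs(1)[OF that(1)] L0[OF that] by simp
  \<comment> \<open>\<open>PiE\<close> asks for functions undefined outside
    \<open>\<Lambda>\<close>. The sums are unaffected, as \<open>rs\<close> is zero on the other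
    blocks.\<close>
  define rs' where "rs' = restrict rs \<Lambda>"
  have "(\<Sum>i\<in>\<Lambda>. rs' i) = r"
    using sum_L[of rs] rs0 rs(2) by (simp add: rs'_def)
  moreover have "rs' i \<in> {0..kk i}" if "i \<in> \<Lambda>" for i
    using that L kk[of i] rs(1)[of i] by (auto simp: rs'_def)
  ultimately have R: "rs' \<in> R"
    by (auto simp: R_def rs'_def)
  then show "R \<noteq> {}"
    by blast
  have "?g rs' = (\<Sum>i<t. grw K B (d i) (Cs i) (rs i))"
    using sum_L[of "\<lambda>i. grw K B (d i) (Cs i) (rs i)"] rs0 grw0 by (simp add: rs'_def)
  then have eq: "?g rs' = grw K B (offs d t) (prodcode t Cs) r"
    using rs(3) upper[OF R] by simp
  show "grw K B (offs d t) (prodcode t Cs) r = Min (?g ` R)"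
    by (rule Min_eqI[symmetric]) (use fin upper R eq in \<open>auto intro: image_eqI[of _ _ rs']\<close>)
qed

end

section \<open>Codes that split along a direct sum of subspaces over the base field\<close>

theorem theorem3:
  fixes K :: "'a::field set" and B :: "'a list" and n t k :: nat
    and M :: "nat \<Rightarrow> nat \<Rightarrow> 'a" and V :: "nat \<Rightarrow> 'a list set"
    and d :: "nat \<Rightarrow> nat" and P :: "nat \<Rightarrow> 'a list list" and C :: "'a list set"
  assumes K: "subfield K"
    and B: "field_basis K B"
    and n: "n \<ge> 1" and mn: "length B \<ge> n"
    and M: "\<forall>i<n. \<forall>j<n. M i j \<in> K"
    and V_sub: "\<forall>i<t. fsubspace K n (V i)"
    and V_inv: "\<forall>i<t. \<forall>v\<in>V i. mulMt n v M \<in> V i"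
    and V_dsum: "\<forall>v\<in>vecs K n. \<exists>!vs. length vs = t \<and> (\<forall>i<t. vs ! i \<in> V i) \<and> v = vsum n vs"
    and d: "\<forall>i<t. d i = fdim K n (V i)"
    and P: "\<forall>i<t. length (P i) = d i \<and> is_basis K n (V i) (P i)"
    and C_sub: "fsubspace UNIV n C"
    and C_M: "\<forall>c\<in>C. mulMt n c M \<in> C"
    and C_dim: "fdim UNIV n C = k" and k: "k \<ge> 1"
    and C_dsum: "\<forall>c\<in>C. \<exists>!cs. length cs = t \<and>
                   (\<forall>i<t. cs ! i \<in> C \<inter> fspan UNIV n (V i)) \<and> c = vsum n cs"
  defines "kk \<equiv> (\<lambda>i. fdim UNIV n (C \<inter> fspan UNIV n (V i)))"
    and "Cs \<equiv> (\<lambda>i. {c \<in> vecs UNIV (d i). lincomb n c (P i) \<in> C \<inter> fspan UNIV n (V i)})"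
    and "\<Lambda> \<equiv> {i. i < t \<and> C \<inter> fspan UNIV n (V i) \<noteq> {zvec n}}"
    and "u \<equiv> (\<lambda>cs. vsum n (map (\<lambda>i. lincomb n (cs ! i) (P i)) [0..<t]))"
  shows
    "(bij_betw u {cs. length cs = t \<and> (\<forall>i<t. cs ! i \<in> Cs i)} C
       \<and> (\<forall>a cs cs'. cs \<in> {cs. length cs = t \<and> (\<forall>i<t. cs ! i \<in> Cs i)} \<and> cs' \<in> {cs. length cs = t \<and> (\<forall>i<t. cs ! i \<in> Cs i)} \<longrightarrow>
            u (map2 (\<lambda>x y. vadd (smult a x) y) cs cs') = vadd (smult a (u cs)) (u cs'))
       \<and> (\<forall>r\<in>{1..k}. grw K B n (prodcode t Cs) r = grw K B n C r))
     \<and> (\<forall>r\<in>{1..k}.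
          grw K B n C r = Min ((\<lambda>rs. \<Sum>i\<in>\<Lambda>. grw K B (d i) (Cs i) (rs i))  ` {rs. rs \<in> (\<Pi>\<^sub>E i\<in>\<Lambda>. {0..kk i}) \<and> (\<Sum>i\<in>\<Lambda>. rs i) = r})
        \<and> grw K B n C r
            = Min ((\<lambda>rs. \<Sum>i\<in>\<Lambda>. grw K B n (C \<inter> fspan UNIV n (V i)) (rs i))  ` {rs. rs \<in> (\<Pi>\<^sub>E i\<in>\<Lambda>. {0..kk i}) \<and> (\<Sum>i\<in>\<Lambda>. rs i) = r}))
     \<and> (\<forall>i\<in>\<Lambda>. \<forall>ri\<in>{1..kk i}. grw K B (d i) (Cs i) ri \<le> d i - kk i + ri)
     \<and> (\<forall>r\<in>{1..k}.
          grw K B n C r \<le> Min ((\<lambda>rs. \<Sum>i\<in>{i\<in>\<Lambda>. rs i \<noteq> 0}. d i - kk i)  ` {rs. rs \<in> (\<Pi>\<^sub>E i\<in>\<Lambda>. {0..kk i}) \<and> (\<Sum>i\<in>\<Lambda>. rs i) = r}) + r)"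
proof -
  interpret finite_extension K B
    by unfold_locales (fact K, fact B)
  let ?A = "\<lambda>i. C \<inter> fspan UNIV n (V i)"
  let ?f = "\<lambda>i c. lincomb n c (P i)"
  define S where "S = {cs. length cs = t \<and> (\<forall>i<t. cs ! i \<in> Cs i)}"
  have Pl: "length (P i) = d i" and Pind: "lin_indep K n (P i)"
    and PV: "set (P i) \<subseteq> V i" and Pspan: "fspan K n (set (P i)) = V i" if "i < t" for i
    using P that unfolding is_basis_def by auto
  have Vv: "V i \<subseteq> vecs K n" if "i < t" for i
    using V_sub that fsubspaceD(1) by blast
  have Pv: "set (P i) \<subseteq> vecs K n" if "i < t" for i
    using PV[OF that] Vv[OF that] by blast
  have vecs_UNIV: "vecs K m \<subseteq> vecs UNIV m" for m
    by (auto simp: vecs_def)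
  have Plen: "length p = n" if "i < t" "p \<in> set (P i)" for i p
    using Pv[OF that(1)] that(2) vecs_length by blast
  have V_img: "V i = ?f i ` vecs K (d i)" if "i < t" for i
    using fspan_set_eq_image[OF K Pv[OF that]] Pspan[OF that] Pl[OF that] by simp
  \<comment> \<open>A basis of \<open>V i\<close> over \<open>K\<close> generates the extended space
    over the large field, so that space consists of the products \<open>c P_i\<close> with arbitrary
    \<open>c\<close>.\<close>
  have VL_img: "fspan UNIV n (V i) = ?f i ` vecs UNIV (d i)" if i: "i < t" for i
  proof -
    have P': "set (P i) \<subseteq> vecs UNIV n"
      using Pv[OF i] vecs_UNIV by blast
    have "V i \<subseteq> fspan UNIV n (set (P i))"
      unfolding Pspan[OF i, symmetric] by (rule fspan_mono_field) simp
    then have "fspan UNIV n (V i) = fspan UNIV n (set (P i))"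
      using fspan_least[OF fspan_fsubspace[OF subfield_UNIV P']] fspan_mono[OF PV[OF i]] by blast
    then show ?thesis
      using fspan_set_eq_image[OF subfield_UNIV P'] Pl[OF i] by simp
  qed
  have A_sub: "fsubspace UNIV n (?A i)" if i: "i < t" for i
  proof -
    have "V i \<subseteq> vecs UNIV n"
      using Vv[OF i] vecs_UNIV by blast
    then show ?thesis
      by (intro fsubspace_Int[OF C_sub] fspan_fsubspace[OF subfield_UNIV])
  qed
  have Cs_sub: "fsubspace UNIV (d i) (Cs i)" if i: "i < t" for i
  proof -
    have "set (P i) \<subseteq> vecs UNIV n"
      using Pv[OF i] vecs_UNIV by blast
    from fsubspace_lincomb_vimage[OF subfield_UNIV this A_sub[OF i]] show ?thesis
      unfolding Cs_def Pl[OF i] .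
  qed
  have Cs_img: "?f i ` Cs i = ?A i" if i: "i < t" for i
    unfolding Cs_def using VL_img[OF i] by auto
  have kk_eq: "kk i = fdim UNIV (d i) (Cs i)" if i: "i < t" for i
    using fdim_UNIV_image[OF Pv[OF i] Pind[OF i], of "Cs i"] Cs_sub[OF i] Pl[OF i] Cs_img[OF i]
    unfolding kk_def by simp
  have grw_A: "grw K B n (?A i) r = grw K B (d i) (Cs i) r" if i: "i < t" for i r
    using grw_image[OF Pv[OF i] Pind[OF i], of "Cs i" r] Cs_sub[OF i] Pl[OF i] Cs_img[OF i]
    by simp

  \<comment> \<open>Stacking the bases turns \<open>u\<close> into multiplication of the
    concatenated vector by one matrix over \<open>K\<close>, so the results on such matrices apply
    to \<open>u\<close>.\<close>
  define Q where "Q = concat (map P [0..<t])"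
  have Qv: "set Q \<subseteq> vecs K n"
    unfolding Q_def using Pv by fastforce
  have Qlen: "length q = n" if "q \<in> set Q" for q
    using Qv that vecs_length by blast
  have lQ: "length Q = offs d t"
    unfolding Q_def by (rule length_concat_offs) (use Pl in auto)
  have u_eq: "u cs = lincomb n (concat cs) Q"
    if cs: "length cs = t" "\<And>i. i < t \<Longrightarrow> length (cs ! i) = d i" for cs
  proof -
    have "map (\<lambda>i. lincomb n (cs ! i) (P i)) [0..<t] = map2 (lincomb n) cs (map P [0..<t])"
      by (rule nth_equalityI) (use cs in auto)
    then show ?thesis
      unfolding u_def Q_def using cs Pl Plen by (subst lincomb_concat) auto
  qed
  \<comment> \<open>A relation among the rows of \<open>Q\<close> splits into contributions from the
    \<open>V i\<close> that add up to zero. Uniqueness of the decomposition of zero kills each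
    contribution, and independence of \<open>P i\<close> kills its coefficients.\<close>
  have Qind: "lin_indep K n Q"
    unfolding lin_indep_def
  proof (intro allI impI)
    fix as assume as: "length as = length Q \<and> set as \<subseteq> K \<and> lincomb n as Q = zvec n"
    define cs where "cs = map (\<lambda>i. slice d i as) [0..<t]"
    have la: "length as = offs d t"
      using as lQ by simp
    have cs: "length cs = t" "\<And>i. i < t \<Longrightarrow> length (cs ! i) = d i" "concat cs = as"
      using length_slice[OF _ la] concat_slices[OF la] by (auto simp: cs_def)
    have csv: "cs ! i \<in> vecs K (d i)" if "i < t" for i
    proof -
      have "cs ! i \<in> set cs"
        using that cs(1) by simp
      then have "set (cs ! i) \<subseteq> set as"
        unfolding cs(3)[symmetric] by auto
      then show ?thesis
        using as cs(2)[OF that] unfolding vecs_def by blast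
    qed
    let ?vs = "map (\<lambda>i. ?f i (cs ! i)) [0..<t]"
    have "vsum n ?vs = zvec n"
      using u_eq[OF cs(1,2)] cs(3) as unfolding u_def by simp
    moreover have "\<forall>i<t. ?vs ! i \<in> V i"
      using csv V_img by simp
    moreover have "vsum n (replicate t (zvec n :: 'a list)) = zvec n"
    proof -
      have "set (replicate t (zvec n :: 'a list)) \<subseteq> {zvec n}"
        by auto
      from vsum_in_fsubspace[OF fsubspace_zero[OF subfield_UNIV] this] show ?thesis
        by simp
    qed
    moreover have "\<forall>i<t. replicate t (zvec n) ! i \<in> V i"
      using fsubspaceD(2)[OF V_sub[rule_format]] by simp
    moreover have "\<exists>!vs. length vs = t \<and> (\<forall>i<t. vs ! i \<in> V i) \<and> zvec n = vsum n vs"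
      using V_dsum fsubspaceD(2)[OF fsubspace_vecs[OF K, of n]] by blast
    ultimately have eq: "?vs = replicate t (zvec n)"
      by (metis (no_types, lifting) length_map length_replicate length_upt minus_nat.diff_0)
    have zero: "set (cs ! i) \<subseteq> {0}" if i: "i < t" for i
    proof -
      have "?vs ! i = zvec n"
        using i unfolding eq by simp
      then have "?f i (cs ! i) = zvec n"
        using i by simp
      then show ?thesis
        using Pind[OF i] csv[OF i] Pl[OF i] unfolding lin_indep_def vecs_def by auto
    qed
    show "set as \<subseteq> {0}"
    proof
      fix x assume "x \<in> set as"
      then obtain c where "c \<in> set cs" "x \<in> set c"
        unfolding cs(3)[symmetric] by auto
      then show "x \<in> {0}"
        using zero cs(1) by (metis in_set_conv_nth subsetD)
    qed
  qed
  have img_K: "(\<lambda>c. lincomb n c Q) ` vecs K (length Q) = vecs K n"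
  proof
    show "(\<lambda>c. lincomb n c Q) ` vecs K (length Q) \<subseteq> vecs K n"
      using fsubspaceD(1)[OF fsubspace_lincomb_image[OF Qv K fsubspace_vecs[OF K]]] .
    show "vecs K n \<subseteq> (\<lambda>c. lincomb n c Q) ` vecs K (length Q)"
    proof
      fix v assume "v \<in> vecs K n"
      then obtain vs where vs: "length vs = t" "\<forall>i<t. vs ! i \<in> V i" "v = vsum n vs"
        using V_dsum by blast
      then have "\<forall>i\<in>{..<t}. \<exists>c. c \<in> vecs K (d i) \<and> vs ! i = ?f i c"
        using V_img by auto
      then obtain g where g: "\<And>i. i < t \<Longrightarrow> g i \<in> vecs K (d i)" "\<And>i. i < t \<Longrightarrow> vs ! i = ?f i (g i)"
        by (metis lessThan_iff)
      define cs where "cs = map g [0..<t]"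
      have cs: "length cs = t" "\<And>i. i < t \<Longrightarrow> length (cs ! i) = d i"
        using g(1) vecs_length by (auto simp: cs_def)
      have "map (\<lambda>i. ?f i (cs ! i)) [0..<t] = vs"
        by (rule nth_equalityI) (use vs g in \<open>auto simp: cs_def\<close>)
      then have "v = lincomb n (concat cs) Q"
        using u_eq[OF cs] vs(3) unfolding u_def by simp
      moreover have "concat cs \<in> vecs K (length Q)"
      proof -
        have "set (g i) \<subseteq> K" if "i < t" for i
          using g(1)[OF that] by (simp add: vecs_def)
        then have "set (concat cs) \<subseteq> K"
          by (fastforce simp: cs_def)
        then show ?thesis
          using length_concat_offs[of cs t d] cs unfolding lQ by (simp add: vecs_def)
      qed
      ultimately show "v \<in> (\<lambda>c. lincomb n c Q) ` vecs K (length Q)"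
        by blast
    qed
  qed
  \<comment> \<open>The rows of \<open>Q\<close> are independent and span \<open>K^n\<close>, so
    \<open>Q\<close> is square and the product code has length \<open>n\<close>.\<close>
  have offs_n: "offs d t = n"
  proof -
    have "inj_on (\<lambda>c. lincomb n c Q) (vecs K (length Q))"
      using K Qlen Qind by (rule lin_indep_inj_on)
    from fdim_lincomb_image[OF Qlen fsubspace_vecs[OF K] this]
    show ?thesis
      using img_K fdim_vecs[OF K] lQ by simp
  qed
  have Cs_len: "length c = d i" if "i < t" "c \<in> Cs i" for i c
    using fsubspaceD(5)[OF Cs_sub[OF that(1)] that(2)] .
  have S_len: "length cs = t" "\<And>i. i < t \<Longrightarrow> length (cs ! i) = d i" if "cs \<in> S" for cs
    using that Cs_len unfolding S_def by auto
  have prod_S: "prodcode t Cs = concat ` S"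
    unfolding prodcode_def S_def by auto
  have u_S: "u cs = lincomb n (concat cs) Q" if "cs \<in> S" for cs
    using S_len[OF that] by (rule u_eq)
  have prod_sub: "fsubspace UNIV (length Q) (prodcode t Cs)"
    unfolding lQ using Cs_sub by (rule fsubspace_prodcode)
  \<comment> \<open>Independence of the rows of \<open>Q\<close>, extended to the large field,
    recovers the concatenation; the known block lengths then recover the components.\<close>
  have inj: "inj_on u S"
  proof (rule inj_onI)
    fix cs cs' assume cs: "cs \<in> S" "cs' \<in> S" and "u cs = u cs'"
    then have "lincomb n (concat cs) Q = lincomb n (concat cs') Q"
      using u_S by simp
    moreover have "concat cs \<in> vecs UNIV (length Q)" "concat cs' \<in> vecs UNIV (length Q)"
      using cs fsubspaceD(1)[OF prod_sub] unfolding prod_S by blast+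
    ultimately have eq: "concat cs = concat cs'"
      using inj_on_UNIV[OF Qv Qind] by (auto dest: inj_onD)
    show "cs = cs'"
    proof (rule nth_equalityI)
      show "length cs = length cs'"
        using S_len(1) cs by metis
      fix i assume "i < length cs"
      then have i: "i < t"
        using S_len(1) cs by metis
      show "cs ! i = cs' ! i"
        using slice_concat[of cs t d i] slice_concat[of cs' t d i] S_len[OF cs(1)] S_len[OF cs(2)] i eq
        by metis
    qed
  qed
  have img: "u ` S = C"
  proof (intro equalityI subsetI)
    fix c assume "c \<in> u ` S"
    then obtain cs where cs: "cs \<in> S" "c = u cs"
      by blast
    have "?f i (cs ! i) \<in> C" if "i < t" for i
      using Cs_img[OF that] cs(1) that unfolding S_def by blast
    then have "set (map (\<lambda>i. ?f i (cs ! i)) [0..<t]) \<subseteq> C"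
      by auto
    then show "c \<in> C"
      unfolding cs(2) u_def by (rule vsum_in_fsubspace[OF C_sub])
  next
    fix c assume "c \<in> C"
    then obtain vs where vs: "length vs = t" "\<forall>i<t. vs ! i \<in> ?A i" "c = vsum n vs"
      using C_dsum by blast
    then have "\<forall>i\<in>{..<t}. \<exists>c. c \<in> Cs i \<and> vs ! i = ?f i c"
      using Cs_img by (metis imageE lessThan_iff)
    then obtain g where g: "\<And>i. i < t \<Longrightarrow> g i \<in> Cs i" "\<And>i. i < t \<Longrightarrow> vs ! i = ?f i (g i)"
      by (metis lessThan_iff)
    define cs where "cs = map g [0..<t]"
    have "cs \<in> S"
      using g(1) by (auto simp: S_def cs_def)
    moreover have "map (\<lambda>i. ?f i (cs ! i)) [0..<t] = vs"
      by (rule nth_equalityI) (use vs g in \<open>auto simp: cs_def\<close>)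
    ultimately show "c \<in> u ` S"
      using vs(3) unfolding u_def by blast
  qed
  have bij: "bij_betw u S C"
    using inj img by (simp add: bij_betw_def)
  have lin: "u (map2 (\<lambda>x y. vadd (smult a x) y) cs cs') = vadd (smult a (u cs)) (u cs')"
    if cs: "cs \<in> S" "cs' \<in> S" for a cs cs'
  proof -
    let ?c = "map2 (\<lambda>x y. vadd (smult a x) y) cs cs'"
    note l = S_len[OF cs(1)] and l' = S_len[OF cs(2)]
    have lf: "length (?f i c) = n" if "i < t" for i c
      using Plen[OF that] by (rule length_lincomb)
    have lu: "length (u c) = n" for c
      unfolding u_def by (rule length_vsum) (auto simp: lf)
    have nu: "u c ! j = (\<Sum>i<t. ?f i (c ! i) ! j)" if "j < n" for c j
      unfolding u_def using that by (subst nth_vsum) (auto simp: lf)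
    have step: "?f i (?c ! i) = vadd (smult a (?f i (cs ! i))) (?f i (cs' ! i))" if i: "i < t" for i
    proof -
      have "?c ! i = vadd (smult a (cs ! i)) (cs' ! i)"
        using l l' i by simp
      then show ?thesis
        using l(2)[OF i] l'(2)[OF i] Pl[OF i] Plen[OF i]
        by (simp add: lincomb_vadd_left lincomb_smult_left)
    qed
    show ?thesis
    proof (rule nth_equalityI)
      fix j assume "j < length (u ?c)"
      then have j: "j < n"
        using lu by simp
      have "u ?c ! j = (\<Sum>i<t. a * ?f i (cs ! i) ! j + ?f i (cs' ! i) ! j)"
        unfolding nu[OF j] by (rule sum.cong[OF refl]) (use step j lf in simp)
      also have "\<dots> = vadd (smult a (u cs)) (u cs') ! j"
        using j by (simp add: lu nu sum.distrib sum_distrib_left)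
      finally show "u ?c ! j = vadd (smult a (u cs)) (u cs') ! j" .
    qed (simp add: lu)
  qed
  have img_prod: "(\<lambda>c. lincomb n c Q) ` prodcode t Cs = C"
    unfolding prod_S img[symmetric] image_image using u_S by (intro image_cong) auto
  have prod_grw: "grw K B n (prodcode t Cs) r = grw K B n C r" for r
    using grw_image[OF Qv Qind prod_sub, of r] unfolding img_prod lQ offs_n by simp
  have prod_dim: "fdim UNIV (offs d t) (prodcode t Cs) = k"
    using fdim_UNIV_image[OF Qv Qind prod_sub] C_dim unfolding img_prod lQ by simp

  have L_sub: "\<Lambda> \<subseteq> {..<t}"
    by (auto simp: \<Lambda>_def)
  have L0: "fdim UNIV (d i) (Cs i) = 0" if "i < t" "i \<notin> \<Lambda>" for i
  proof -
    have "?A i = {zvec n}"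
      using that by (simp add: \<Lambda>_def)
    then show ?thesis
      using kk_eq[OF that(1)] unfolding kk_def by (simp add: fdim_zero[OF subfield_UNIV])
  qed
  let ?R = "\<lambda>r. {rs. rs \<in> (\<Pi>\<^sub>E i\<in>\<Lambda>. {0..kk i}) \<and> (\<Sum>i\<in>\<Lambda>. rs i) = r}"
  have finR: "finite (?R r)" and neR: "?R r \<noteq> {}"
    and minR: "grw K B n C r = Min ((\<lambda>rs. \<Sum>i\<in>\<Lambda>. grw K B (d i) (Cs i) (rs i)) ` ?R r)"
    if "r \<le> k" for r
  proof -
    have r: "r \<le> fdim UNIV (offs d t) (prodcode t Cs)"
      using that prod_dim by simp
    note facts = grw_prodcode_eq_Min[of t d Cs r \<Lambda> kk, OF Cs_sub r L_sub L0 kk_eq, simplified offs_n prod_grw]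
    show "finite (?R r)" "?R r \<noteq> {}"
      "grw K B n C r = Min ((\<lambda>rs. \<Sum>i\<in>\<Lambda>. grw K B (d i) (Cs i) (rs i)) ` ?R r)"
      using facts by auto
  qed
  have minA: "grw K B n C r = Min ((\<lambda>rs. \<Sum>i\<in>\<Lambda>. grw K B n (?A i) (rs i)) ` ?R r)" if "r \<le> k" for r
  proof -
    have "(\<lambda>rs. \<Sum>i\<in>\<Lambda>. grw K B n (?A i) (rs i)) = (\<lambda>rs. \<Sum>i\<in>\<Lambda>. grw K B (d i) (Cs i) (rs i))"
      using grw_A L_sub by (intro ext sum.cong) auto
    then show ?thesis
      using minR[OF that] by (simp only:)
  qed
  have part3: "grw K B (d i) (Cs i) ri \<le> d i - kk i + ri" if "i \<in> \<Lambda>" "ri \<le> kk i" for i ri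
  proof -
    have i: "i < t"
      using that L_sub by auto
    show ?thesis
      using grw_singleton_bound[OF Cs_sub[OF i], of ri] that(2) kk_eq[OF i] by simp
  qed
  have part4: "grw K B n C r \<le> Min ((\<lambda>rs. \<Sum>i\<in>{i\<in>\<Lambda>. rs i \<noteq> 0}. d i - kk i) ` ?R r) + r"
    if r: "r \<le> k" for r
  proof -
    \<comment> \<open>The tuple is taken optimal for the right-hand side, since by
      \<open>minR\<close> every admissible tuple bounds the weight of \<open>C\<close> from
      above.\<close>
    have "Min ((\<lambda>rs. \<Sum>i\<in>{i\<in>\<Lambda>. rs i \<noteq> 0}. d i - kk i) ` ?R r)
        \<in> (\<lambda>rs. \<Sum>i\<in>{i\<in>\<Lambda>. rs i \<noteq> 0}. d i - kk i) ` ?R r"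
      using finR[OF r] neR[OF r] by (intro Min_in) auto
    then obtain rs where rs: "rs \<in> ?R r"
        "Min ((\<lambda>rs. \<Sum>i\<in>{i\<in>\<Lambda>. rs i \<noteq> 0}. d i - kk i) ` ?R r) = (\<Sum>i\<in>{i\<in>\<Lambda>. rs i \<noteq> 0}. d i - kk i)"
      by blast
    have finL: "finite \<Lambda>"
      using L_sub finite_subset by blast
    have "grw K B n C r \<le> (\<Sum>i\<in>\<Lambda>. grw K B (d i) (Cs i) (rs i))"
      unfolding minR[OF r] using finR[OF r] rs(1) by (intro Min_le) auto
    \<comment> \<open>An index with \<open>rs i = 0\<close> contributes \<open>0\<close> by the
      convention for \<open>grw\<close>, so \<open>d i - kk i\<close> is charged only where the
      share is nonzero.\<close>
    also have "\<dots> \<le> (\<Sum>i\<in>\<Lambda>. (if rs i \<noteq> 0 then d i - kk i else 0) + rs i)"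
    proof (rule sum_mono)
      fix i assume i: "i \<in> \<Lambda>"
      then have "rs i \<le> kk i"
        using rs(1) by (auto simp: PiE_iff)
      then show "grw K B (d i) (Cs i) (rs i) \<le> (if rs i \<noteq> 0 then d i - kk i else 0) + rs i"
        using part3[OF i] by (auto simp: grw_def[of _ _ _ _ 0])
    qed
    also have "\<dots> = (\<Sum>i\<in>{i\<in>\<Lambda>. rs i \<noteq> 0}. d i - kk i) + r"
      using rs(1) finL by (simp add: sum.distrib sum.inter_filter[symmetric])
    finally show ?thesis
      using rs(2) by simp
  qed
  show ?thesis
    unfolding S_def[symmetric]
    using bij lin prod_grw minR minA part3 part4
    by (intro conjI ballI allI impI) (simp_all only: atLeastAtMost_iff)
qed

end
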